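(* Let $n\ge2$. For any $c\in W_{D_{n+1}^{(2)}}^0=\mathcal C_{2n}^s$, we have $$L_{D_{n+1}^{(2)}}(c)=\frac12\big(L(c)+a_0(c)+a_n(c)\big).$$
   Context: A $2n$-core is a partition having no hook length equal to $2n$; $\mathcal C_{2n}$ is the set of $2n$-cores and $\mathcal C_{2n}^s$ the subset of self-conjugate ones. The box in row $i$, column $j$ has residue $(j-i)\bmod 2n$; boxes of residue $i$ are $i$-nodes. The affine Weyl group $\widetilde{\mathfrak S}_{2n}$ of type $A_{2n-1}^{(1)}$, with simple reflections $s_0,\dots,s_{2n-1}$, acts on $\mathcal C_{2n}$: $s_i\cdot c$ is obtained by removing all removable $i$-nodes of $c$ if there are some, adding all addable $i$-nodes if there are some, and $s_i\cdot c=c$ otherwise. $L(c)$ denotes the number of boxes of $c$ and $a_i(c)$ the number of boxes of $c$ of residue $i$. Let $\alpha_0,\dots,\alpha_{2n-1}$ and $\Lambda_0,\dots,\Lambda_{2n-1}$ be the simple roots and fundamental weights of the affine root system of type $A_{2n-1}^{(1)}$, on which $\widetilde{\mathfrak S}_{2n}$ acts by $s_i(x)=x-\langle x,\alpha_i^\vee\rangle\alpha_i$. The affine root system of type $D_{n+1}^{(2)}$ is realized by $\alpha_0^{D_{n+1}^{(2)}}=\alpha_0$, $\alpha_i^{D_{n+1}^{(2)}}=\alpha_i+\alpha_{2n-i}$ ($1\le i\le n-1$), $\alpha_n^{D_{n+1}^{(2)}}=\alpha_n$, $\Lambda_0^{D_{n+1}^{(2)}}=\Lambda_0$, and its Weyl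 group $W_{D_{n+1}^{(2)}}$ as the subgroup of $\widetilde{\mathfrak S}_{2n}$ generated by $s_0$, $s_is_{2n-i}$ ($1\le i\le n-1$), $s_n$. The affine Grassmannian $W_{D_{n+1}^{(2)}}^0$ (minimal length representatives of left cosets modulo the finite Weyl group generated by all these generators except $s_0$) is identified with $\mathcal C_{2n}^s$ via $w\mapsto w\cdot\varnothing$. The atomic length: for $w\in W_{D_{n+1}^{(2)}}^0$ with $c=w\cdot\varnothing$, write $\Lambda_0^{D_{n+1}^{(2)}}-w(\Lambda_0^{D_{n+1}^{(2)}})=\sum_{i=0}^n a_i^{D_{n+1}^{(2)}}(c)\,\alpha_i^{D_{n+1}^{(2)}}$; then $L_{D_{n+1}^{(2)}}(c)=\sum_{i=0}^n a_i^{D_{n+1}^{(2)}}(c)$. *)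

theory Defs
  imports "HOL-Analysis.Finite_Function_Topology" "HOL-Algebra.Coset" "HOL-Algebra.Bij"
    "HOL-Algebra.Generated_Groups"
begin

section \<open>Partitions, cores and residues\<close>

text \<open>
  A partition is identified with its Young diagram. Boxes are pairs (row, column), with rows and
  columns counted from 0; the residue of a box depends only on (column - row), so it agrees with
  the one obtained when counting from 1.
\<close>

type_synonym box = "nat \<times> nat"

definition is_partition :: "box set \<Rightarrow> bool" where
  "is_partition c \<longleftrightarrow>
     finite c \<and> (\<forall>i j i' j'. (i, j) \<in> c \<longrightarrow> i' \<le> i \<longrightarrow> j' \<le> j \<longrightarrow> (i', j') \<in> c)"

definition hook_length :: "box set \<Rightarrow> box \<Rightarrow> nat" where
  "hook_length c = (\<lambda>(i, j). card {j'. j < j' \<and> (i, j') \<in> c} + card {i'. i < i' \<and> (i', j) \<in> c} + 1)"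

definition cores :: "nat \<Rightarrow> box set set" where
  "cores m = {c. is_partition c \<and> (\<forall>b\<in>c. hook_length c b \<noteq> m)}"

definition self_conjugate_cores :: "nat \<Rightarrow> box set set" where
  "self_conjugate_cores m = {c \<in> cores m. prod.swap ` c = c}"

definition residue :: "nat \<Rightarrow> box \<Rightarrow> nat" where
  "residue m = (\<lambda>(i, j). nat ((int j - int i) mod int m))"

definition num_nodes :: "nat \<Rightarrow> nat \<Rightarrow> box set \<Rightarrow> nat" where
  "num_nodes m i c = card {b \<in> c. residue m b = i}"

definition addable_nodes :: "nat \<Rightarrow> nat \<Rightarrow> box set \<Rightarrow> box set" where
  "addable_nodes m i c = {b. b \<notin> c \<and> is_partition (insert b c) \<and> residue m b = i}"

definition removable_nodes :: "nat \<Rightarrow> nat \<Rightarrow> box set \<Rightarrow> box set" where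
  "removable_nodes m i c = {b \<in> c. is_partition (c - {b}) \<and> residue m b = i}"

definition core_reflection :: "nat \<Rightarrow> nat \<Rightarrow> box set \<Rightarrow> box set" where
  "core_reflection m i c =
     (if removable_nodes m i c \<noteq> {} then c - removable_nodes m i c
      else if addable_nodes m i c \<noteq> {} then c \<union> addable_nodes m i c
      else c)"


section \<open>The affine root system of type $A_{m-1}^{(1)}$ and its Weyl group\<close>

text \<open>
  Weights are written in the basis formed by the fundamental weights and the null root delta, so
  the coefficient at \<open>Fund i\<close> is the pairing with the i-th simple coroot, and the coefficient
  at \<open>Delta\<close> is the pairing with the scaling element d. For given m only the indices
  i < m are relevant: the remaining basis vectors do not occur in the simple roots and are fixed
  by all reflections, so they do not affect the Weyl group.
\<close>

datatype weight_index = Fund nat | Delta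

type_synonym weight = "weight_index \<Rightarrow>\<^sub>0 real"

definition fund_weight :: "nat \<Rightarrow> weight" where
  "fund_weight i = Poly_Mapping.single (Fund i) 1"

definition null_root :: weight where
  "null_root = Poly_Mapping.single Delta 1"

definition pairing :: "weight \<Rightarrow> nat \<Rightarrow> real" where
  "pairing x i = Poly_Mapping.lookup x (Fund i)"

text \<open>Correct for m \<ge> 3 only (for m = 2 the off-diagonal entries would be -2).\<close>

definition cartan :: "nat \<Rightarrow> nat \<Rightarrow> nat \<Rightarrow> real" where
  "cartan m i j = (if i = j then 2 else if Suc i mod m = j \<or> Suc j mod m = i then -1 else 0)"

definition simple_root :: "nat \<Rightarrow> nat \<Rightarrow> weight" where
  "simple_root m i =
     (\<Sum>j<m. cartan m j i *\<^sub>R fund_weight j) + (if i = 0 then null_root else 0)"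

definition reflection :: "nat \<Rightarrow> nat \<Rightarrow> weight \<Rightarrow> weight" where
  "reflection m i x = x - pairing x i *\<^sub>R simple_root m i"

text \<open>
  The action on cores of an element \<open>w\<close> of the affine Weyl group, obtained by writing
  \<open>w\<close> as any product of simple reflections.
\<close>

definition core_action :: "nat \<Rightarrow> (weight \<Rightarrow> weight) \<Rightarrow> box set \<Rightarrow> box set" where
  "core_action m w c =
     (THE d. \<exists>is \<in> lists {..<m}. w = foldr (reflection m) is \<and> d = foldr (core_reflection m) is c)"


section \<open>Type $D_{n+1}^{(2)}$ inside type $A_{2n-1}^{(1)}$\<close>

definition D_simple_root :: "nat \<Rightarrow> nat \<Rightarrow> weight" where
  "D_simple_root n i =
     (if i = 0 \<or> i = n then simple_root (2*n) i
      else simple_root (2*n) i + simple_root (2*n) (2*n - i))"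

definition D_fund_weight0 :: weight where
  "D_fund_weight0 = fund_weight 0"

definition D_generator :: "nat \<Rightarrow> nat \<Rightarrow> weight \<Rightarrow> weight" where
  "D_generator n i =
     (if i = 0 \<or> i = n then reflection (2*n) i
      else reflection (2*n) i \<circ> reflection (2*n) (2*n - i))"

definition D_weyl :: "nat \<Rightarrow> (weight \<Rightarrow> weight) set" where
  "D_weyl n = generate (BijGroup UNIV) (D_generator n ` {0..n})"

definition D_finite_weyl :: "nat \<Rightarrow> (weight \<Rightarrow> weight) set" where
  "D_finite_weyl n = generate (BijGroup UNIV) (D_generator n ` {1..n})"

definition D_length :: "nat \<Rightarrow> (weight \<Rightarrow> weight) \<Rightarrow> nat" where
  "D_length n w = (LEAST k. \<exists>is \<in> lists {0..n}. length is = k \<and> w = foldr (D_generator n) is)"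

definition D_grassmannian :: "nat \<Rightarrow> (weight \<Rightarrow> weight) set" where
  "D_grassmannian n =
     {w \<in> D_weyl n. \<forall>v \<in> w <#\<^bsub>BijGroup UNIV\<^esub> D_finite_weyl n. D_length n w \<le> D_length n v}"

text \<open>
  The coefficients of \<open>\<Lambda>\<^sub>0 - w(\<Lambda>\<^sub>0)\<close> on the simple roots, as a function of the
  self-conjugate core \<open>c = w \<cdot> \<emptyset>\<close> with which the affine Grassmannian element \<open>w\<close>
  is identified. The coefficient function is set to 0 outside the index range.
\<close>

definition D_coeff :: "nat \<Rightarrow> box set \<Rightarrow> nat \<Rightarrow> real" where
  "D_coeff n c =
     (THE a. (\<forall>i>n. a i = 0) \<and>
        (\<exists>w \<in> D_grassmannian n. core_action (2*n) w {} = c \<and>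
           D_fund_weight0 - w D_fund_weight0 = (\<Sum>i=0..n. a i *\<^sub>R D_simple_root n i)))"

definition D_atomic_length :: "nat \<Rightarrow> box set \<Rightarrow> real" where
  "D_atomic_length n c = (\<Sum>i=0..n. D_coeff n c i)"

end

theory Submission
  imports Defs
begin

text \<open>
  Everything is read off from one vector, the weight
  \<open>wt c = \<Lambda>\<^sub>0 - (\<Sum>b\<in>c. \<alpha>\<^bsub>res b\<^esub>)\<close> of a partition \<open>c\<close>, which records the
  numbers \<open>a\<^sub>i(c)\<close>. On \<open>m\<close>-cores the map \<open>wt\<close> is equivariant, \<open>wt (s\<^sub>i \<cdot> c) = s\<^sub>i (wt c)\<close>, and
  injective. Hence \<open>w \<cdot> \<emptyset> = c\<close> says exactly that \<open>w(\<Lambda>\<^sub>0) = wt c\<close>, and then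
  \<open>\<Lambda>\<^sub>0 - w(\<Lambda>\<^sub>0)\<close> is the sum of the simple roots \<open>\<alpha>\<^sub>i\<close> with multiplicities \<open>a\<^sub>i(c)\<close>. When
  \<open>c\<close> is self-conjugate, conjugation gives \<open>a\<^sub>i(c) = a\<^bsub>2n-i\<^esub>(c)\<close>, so this sum is
  \<open>\<Sum>i\<le>n. a\<^sub>i(c) \<alpha>\<^sub>i\<close> in terms of the simple roots of type D. The atomic length therefore counts
  each pair of opposite residues once, whereas \<open>L(c)\<close> counts both members; only
  the residues \<open>0\<close> and \<open>n\<close> are their own opposites, which is the stated formula.

  Equivariance rests on two facts. For every partition, the number of addable minus the number of
  removable \<open>i\<close>-nodes is the pairing of \<open>wt c\<close> with the \<open>i\<close>-th simple coroot
  (\<open>card_addable_minus_card_removable\<close>); this is a telescoping sum along the rows. A core does not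
  have both addable and removable \<open>i\<close>-nodes (\<open>core_not_addable_and_removable\<close>), so \<open>s\<^sub>i\<close> changes
  the number of \<open>i\<close>-nodes by precisely this pairing. The second fact comes from the bead description:
  a partition with row lengths \<open>\<lambda>\<^sub>r\<close> has beads at the integers \<open>\<lambda>\<^sub>r - r - 1\<close>, and it is an
  \<open>m\<close>-core iff the set of beads is closed under subtracting \<open>m\<close>. Adding or removing a box moves one
  bead by one place.

  Injectivity (\<open>partition_weight_inj_on_cores\<close>) is obtained by peeling: two cores of equal weight
  have the same pairings, so they have removable nodes of the same residues, and reflecting both
  makes them smaller. It also shows that the action of \<open>w\<close> on the empty core is independent of the word
  chosen for \<open>w\<close>, and, applied to two commuting reflections, that \<open>s\<^sub>i s\<^bsub>2n-i\<^esub>\<close> preserves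
  self-conjugacy. Peeling opposite residues together then writes each self-conjugate core as
  \<open>w \<cdot> \<emptyset>\<close> with \<open>w\<close> in the Weyl group of type D. Passing to a shortest element of the coset of
  \<open>w\<close> does not change \<open>w(\<Lambda>\<^sub>0)\<close>, because the finite Weyl group fixes \<open>\<Lambda>\<^sub>0\<close>. Finally, linear
  independence of the simple roots makes the coefficients unique.
\<close>

section \<open>Row lengths and beads of a partition\<close>

lemma finite_initial_segment_iff_less_card:
  fixes A :: "nat set"
  assumes "finite A" and down: "\<And>x y. x \<in> A \<Longrightarrow> y \<le> x \<Longrightarrow> y \<in> A"
  shows "x \<in> A \<longleftrightarrow> x < card A"
proof -
  define k where "k = (LEAST k. k \<notin> A)"
  have ex: "\<exists>k. k \<notin> A"
    using assms(1) ex_new_if_finite infinite_UNIV_nat by blast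
  have "k \<notin> A"
    unfolding k_def using ex by (rule LeastI_ex)
  moreover have "y \<in> A" if "y < k" for y
    using that not_less_Least unfolding k_def by blast
  ultimately have "A = {..<k}"
    using down by (auto simp: not_less[symmetric])
  then show ?thesis by simp
qed

definition row_length :: "box set \<Rightarrow> nat \<Rightarrow> nat" where
  "row_length c r = card {j. (r, j) \<in> c}"

definition col_length :: "box set \<Rightarrow> nat \<Rightarrow> nat" where
  "col_length c j = card {r. (r, j) \<in> c}"

text \<open>
  The integers index the steps of the boundary path of the diagram: a bead stands for a vertical step
  (the end of a row), a gap for a horizontal one (the bottom of a column).
\<close>

definition bead :: "box set \<Rightarrow> nat \<Rightarrow> int" where
  "bead c r = int (row_length c r) - int r - 1"

definition beads :: "box set \<Rightarrow> int set" where
  "beads c = range (bead c)"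

definition gap :: "box set \<Rightarrow> nat \<Rightarrow> int" where
  "gap c j = int j - int (col_length c j)"

lemma bead_in_beads [simp]: "bead c r \<in> beads c"
  by (simp add: beads_def)

lemma is_partition_finite: "is_partition c \<Longrightarrow> finite c"
  by (simp add: is_partition_def)

lemma is_partition_downD: "is_partition c \<Longrightarrow> (i, j) \<in> c \<Longrightarrow> i' \<le> i \<Longrightarrow> j' \<le> j \<Longrightarrow> (i', j') \<in> c"
  unfolding is_partition_def by blast

lemma is_partition_empty [simp]: "is_partition {}"
  by (simp add: is_partition_def)

lemma is_partition_Un: "is_partition c \<Longrightarrow> is_partition d \<Longrightarrow> is_partition (c \<union> d)"
  by (auto simp: is_partition_def)

lemma is_partition_Int: "is_partition c \<Longrightarrow> is_partition d \<Longrightarrow> is_partition (c \<inter> d)"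
  by (auto simp: is_partition_def)

lemma in_partition_iff_row_length:
  assumes "is_partition c"
  shows "(r, j) \<in> c \<longleftrightarrow> j < row_length c r"
proof -
  have "finite {j. (r, j) \<in> c}"
    by (rule finite_subset[of _ "snd ` c"]) (use is_partition_finite[OF assms] in \<open>force+\<close>)
  then show ?thesis
    using finite_initial_segment_iff_less_card[of "{j. (r, j) \<in> c}" j] is_partition_downD[OF assms]
    by (auto simp: row_length_def)
qed

lemma in_partition_iff_col_length:
  assumes "is_partition c"
  shows "(r, j) \<in> c \<longleftrightarrow> r < col_length c j"
proof -
  have "finite {r. (r, j) \<in> c}"
    by (rule finite_subset[of _ "fst ` c"]) (use is_partition_finite[OF assms] in \<open>force+\<close>)
  then show ?thesis
    using finite_initial_segment_iff_less_card[of "{r. (r, j) \<in> c}" r] is_partition_downD[OF assms]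
    by (auto simp: col_length_def)
qed

lemma row_length_antimono:
  assumes "is_partition c" "r \<le> r'"
  shows "row_length c r' \<le> row_length c r"
proof (rule ccontr)
  assume "\<not> ?thesis"
  then have "(r', row_length c r) \<in> c"
    by (simp add: in_partition_iff_row_length[OF assms(1)])
  then have "(r, row_length c r) \<in> c"
    using is_partition_downD[OF assms(1)] assms(2) by blast
  then show False
    by (simp add: in_partition_iff_row_length[OF assms(1)])
qed

lemma bead_strict_antimono:
  assumes "is_partition c" "r < r'"
  shows "bead c r' < bead c r"
  using row_length_antimono[OF assms(1), of r r'] assms(2) by (simp add: bead_def)

lemma row_length_eventually_zero:
  assumes "is_partition c"
  obtains N where "\<And>r. r \<ge> N \<Longrightarrow> row_length c r = 0"
proof
  fix r assume "Suc (Max (insert 0 (fst ` c))) \<le> r"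
  then have "r > Max (insert 0 (fst ` c))" by simp
  then have "(r, 0) \<notin> c"
    using is_partition_finite[OF assms] by (force simp: Max_less_iff)
  then show "row_length c r = 0"
    using in_partition_iff_row_length[OF assms] by auto
qed

text \<open>
  Beads strictly decrease from row to row, so the place just below the bead of a row can be occupied
  only by the bead of the next row.
\<close>

lemma bead_pred_in_beads_iff:
  assumes "is_partition c"
  shows "bead c r - 1 \<in> beads c \<longleftrightarrow> row_length c (Suc r) = row_length c r"
proof
  assume "bead c r - 1 \<in> beads c"
  then obtain s where s: "bead c r - 1 = bead c s"
    by (auto simp: beads_def)
  have "s = Suc r"
  proof (rule ccontr)
    assume "s \<noteq> Suc r"
    then consider "s \<le> r" | "Suc r < s" by linarith
    then show False
    proof cases
      case 1
      then show ?thesis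
        using s bead_strict_antimono[OF assms, of s r] by (cases "s = r") auto
    next
      case 2
      then show ?thesis
        using s bead_strict_antimono[OF assms, of "Suc r" s]
          bead_strict_antimono[OF assms, of r "Suc r"] by simp
    qed
  qed
  then show "row_length c (Suc r) = row_length c r"
    using s by (simp add: bead_def)
next
  assume "row_length c (Suc r) = row_length c r"
  then have "bead c r - 1 = bead c (Suc r)"
    by (simp add: bead_def)
  then show "bead c r - 1 \<in> beads c"
    by simp
qed

lemma bead_succ_in_beads_iff:
  assumes "is_partition c"
  shows "bead c r + 1 \<in> beads c \<longleftrightarrow> r \<noteq> 0 \<and> row_length c r = row_length c (r - 1)"
proof (cases r)
  case 0
  have "bead c 0 + 1 \<noteq> bead c s" for s
    using bead_strict_antimono[OF assms, of 0 s] by (cases "s = 0") auto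
  then have "bead c 0 + 1 \<notin> beads c"
    unfolding beads_def by blast
  then show ?thesis
    using 0 by simp
next
  case (Suc q)
  show ?thesis
  proof
    assume "bead c r + 1 \<in> beads c"
    then obtain s where s: "bead c r + 1 = bead c s"
      by (auto simp: beads_def)
    then have "s < r"
      using bead_strict_antimono[OF assms, of r s] by (cases s r rule: linorder_cases) auto
    then have "s = q"
      using s Suc bead_strict_antimono[OF assms, of s q] bead_strict_antimono[OF assms, of q r]
      by (cases "s = q") auto
    then show "r \<noteq> 0 \<and> row_length c r = row_length c (r - 1)"
      using s Suc by (simp add: bead_def)
  next
    assume "r \<noteq> 0 \<and> row_length c r = row_length c (r - 1)"
    then have "bead c r + 1 = bead c q"
      using Suc by (simp add: bead_def)
    then show "bead c r + 1 \<in> beads c" by simp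
  qed
qed

section \<open>Addable and removable boxes\<close>

text \<open>
  Removing a corner moves the bead of its row one place down, which is possible iff that place is
  empty. Adding a box moves a bead one place up, see \<open>is_partition_insert_iff\<close>.
\<close>

lemma is_partition_remove_iff:
  assumes c: "is_partition c"
  shows "(r, j) \<in> c \<and> is_partition (c - {(r, j)}) \<longleftrightarrow>
    Suc j = row_length c r \<and> bead c r - 1 \<notin> beads c"
proof
  assume A: "(r, j) \<in> c \<and> is_partition (c - {(r, j)})"
  have "(r, Suc j) \<notin> c" "(Suc r, j) \<notin> c"
    using A is_partition_downD[of "c - {(r, j)}" _ _ r j] by (metis Diff_iff Suc_n_not_le_n insertCI le_SucI order_refl prod.inject singletonD)+
  then show "Suc j = row_length c r \<and> bead c r - 1 \<notin> beads c"
    using A by (simp add: in_partition_iff_row_length[OF c] bead_pred_in_beads_iff[OF c])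
next
  assume A: "Suc j = row_length c r \<and> bead c r - 1 \<notin> beads c"
  then have "row_length c (Suc r) \<le> j"
    using row_length_antimono[OF c, of r "Suc r"] by (simp add: bead_pred_in_beads_iff[OF c])
  then have out: "(r, Suc j) \<notin> c" "(Suc r, j) \<notin> c" "(r, j) \<in> c"
    using A by (simp_all add: in_partition_iff_row_length[OF c])
  have "(i', j') \<in> c - {(r, j)}" if "(i, k) \<in> c - {(r, j)}" "i' \<le> i" "j' \<le> k" for i k i' j'
  proof -
    have "(i', j') \<noteq> (r, j)"
    proof
      assume "(i', j') = (r, j)"
      then have "r < i \<and> j \<le> k \<or> r \<le> i \<and> j < k"
        using that by auto
      then show False
        using that(1) out is_partition_downD[OF c, of i k "Suc r" j] is_partition_downD[OF c, of i k r "Suc j"]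
        by auto
    qed
    then show ?thesis
      using that is_partition_downD[OF c] by blast
  qed
  then show "(r, j) \<in> c \<and> is_partition (c - {(r, j)})"
    using out is_partition_finite[OF c] unfolding is_partition_def by blast
qed

lemma is_partition_insert_iff:
  assumes c: "is_partition c"
  shows "(r, j) \<notin> c \<and> is_partition (insert (r, j) c) \<longleftrightarrow>
    j = row_length c r \<and> bead c r + 1 \<notin> beads c"
proof
  assume A: "(r, j) \<notin> c \<and> is_partition (insert (r, j) c)"
  have 1: "j = row_length c r"
  proof (rule ccontr)
    assume "j \<noteq> row_length c r"
    then have "(r, row_length c r) \<in> insert (r, j) c"
      using A is_partition_downD[of "insert (r, j) c" r j r "row_length c r"]
      by (simp add: in_partition_iff_row_length[OF c])
    then show False
      using \<open>j \<noteq> row_length c r\<close> by (simp add: in_partition_iff_row_length[OF c])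
  qed
  have 2: "j < row_length c (r - 1)" if "r \<noteq> 0"
  proof -
    have "(r - 1, j) \<in> insert (r, j) c"
      using A is_partition_downD[of "insert (r, j) c" r j "r - 1" j] by simp
    moreover have "r - 1 \<noteq> r"
      using that by simp
    ultimately show ?thesis
      by (simp add: in_partition_iff_row_length[OF c])
  qed
  show "j = row_length c r \<and> bead c r + 1 \<notin> beads c"
    using 1 2 by (auto simp: bead_succ_in_beads_iff[OF c])
next
  assume A: "j = row_length c r \<and> bead c r + 1 \<notin> beads c"
  then have out: "(r, j) \<notin> c"
    by (simp add: in_partition_iff_row_length[OF c])
  have above: "(i', j') \<in> insert (r, j) c" if "i' \<le> r" "j' \<le> j" for i' j'
  proof (cases "i' = r")
    case True
    then show ?thesis
      using that A by (auto simp: in_partition_iff_row_length[OF c])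
  next
    case False
    then have "j < row_length c (r - 1)"
      using that A row_length_antimono[OF c, of "r - 1" r]
      by (auto simp: bead_succ_in_beads_iff[OF c])
    then have "(r - 1, j) \<in> c"
      by (simp add: in_partition_iff_row_length[OF c])
    then show ?thesis
      using False that is_partition_downD[OF c, of "r - 1" j i' j'] by simp
  qed
  have "(i', j') \<in> insert (r, j) c" if "(i, k) \<in> insert (r, j) c" "i' \<le> i" "j' \<le> k" for i k i' j'
    using that above is_partition_downD[OF c] by blast
  then show "(r, j) \<notin> c \<and> is_partition (insert (r, j) c)"
    using out is_partition_finite[OF c] unfolding is_partition_def by blast
qed

lemma residue_eq_iff: "i < m \<Longrightarrow> residue m (r, j) = i \<longleftrightarrow> (int j - int r) mod int m = int i"
  by (auto simp: residue_def)

lemma residue_less: "0 < m \<Longrightarrow> residue m b < m"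
  by (cases b) (auto simp: residue_def nat_less_iff)

lemma removable_nodes_iff:
  assumes "is_partition c" "i < m"
  shows "(r, j) \<in> removable_nodes m i c \<longleftrightarrow>
    Suc j = row_length c r \<and> bead c r - 1 \<notin> beads c \<and> bead c r mod int m = int i"
proof -
  have "(r, j) \<in> removable_nodes m i c \<longleftrightarrow>
    (Suc j = row_length c r \<and> bead c r - 1 \<notin> beads c) \<and> residue m (r, j) = i"
    unfolding is_partition_remove_iff[OF assms(1), symmetric] by (auto simp: removable_nodes_def)
  moreover have "int j - int r = bead c r" if "Suc j = row_length c r"
    using that by (simp add: bead_def)
  ultimately show ?thesis
    by (auto simp: residue_eq_iff[OF assms(2)])
qed

lemma addable_nodes_iff:
  assumes "is_partition c" "i < m"
  shows "(r, j) \<in> addable_nodes m i c \<longleftrightarrow>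
    j = row_length c r \<and> bead c r + 1 \<notin> beads c \<and> (bead c r + 1) mod int m = int i"
proof -
  have "(r, j) \<in> addable_nodes m i c \<longleftrightarrow>
    (j = row_length c r \<and> bead c r + 1 \<notin> beads c) \<and> residue m (r, j) = i"
    unfolding is_partition_insert_iff[OF assms(1), symmetric] by (auto simp: addable_nodes_def)
  moreover have "int j - int r = bead c r + 1" if "j = row_length c r"
    using that by (simp add: bead_def)
  ultimately show ?thesis
    by (auto simp: residue_eq_iff[OF assms(2)])
qed

lemma removable_nodes_subset: "removable_nodes m i c \<subseteq> c"
  by (auto simp: removable_nodes_def)

lemma finite_removable_nodes: "is_partition c \<Longrightarrow> finite (removable_nodes m i c)"
  using finite_subset[OF removable_nodes_subset] is_partition_finite by blast

lemma addable_nodes_disjoint: "addable_nodes m i c \<inter> c = {}"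
  by (auto simp: addable_nodes_def)

lemma finite_addable_nodes:
  assumes c: "is_partition c" and "i < m"
  shows "finite (addable_nodes m i c)"
proof -
  obtain N where N: "\<And>r. r \<ge> N \<Longrightarrow> row_length c r = 0"
    using row_length_eventually_zero[OF c] by blast
  have "addable_nodes m i c \<subseteq> (\<lambda>r. (r, row_length c r)) ` {..N}"
  proof
    fix b assume b: "b \<in> addable_nodes m i c"
    obtain r j where rj: "b = (r, j)" by fastforce
    have "r \<le> N"
    proof (rule ccontr)
      assume "\<not> r \<le> N"
      then have "row_length c r = row_length c (r - 1)"
        using N by simp
      then show False
        using b \<open>\<not> r \<le> N\<close> by (simp add: rj addable_nodes_iff[OF assms] bead_succ_in_beads_iff[OF c])
    qed
    then show "b \<in> (\<lambda>r. (r, row_length c r)) ` {..N}"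
      using b by (auto simp: rj addable_nodes_iff[OF assms])
  qed
  then show ?thesis
    by (rule finite_subset) simp
qed

text \<open>
  Removable boxes are maximal elements of the diagram, so any set of them can be removed at once.
\<close>

lemma is_partition_remove_removable:
  assumes c: "is_partition c" and R: "R \<subseteq> removable_nodes m i c"
  shows "is_partition (c - R)"
proof -
  have "(i', j') \<in> c - R" if "(k, l) \<in> c - R" "i' \<le> k" "j' \<le> l" for k l i' j'
  proof -
    have "(i', j') \<notin> R"
    proof
      assume "(i', j') \<in> R"
      then have "is_partition (c - {(i', j')})"
        using R by (auto simp: removable_nodes_def)
      moreover have "(k, l) \<in> c - {(i', j')}"
        using that \<open>(i', j') \<in> R\<close> by auto
      ultimately show False
        using that is_partition_downD by blast
    qed
    then show ?thesis
      using that is_partition_downD[OF c] by blast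
  qed
  then show ?thesis
    using is_partition_finite[OF c] unfolding is_partition_def by blast
qed

lemma is_partition_add_addable:
  assumes c: "is_partition c" and "i < m" and A: "A \<subseteq> addable_nodes m i c"
  shows "is_partition (c \<union> A)"
proof -
  have "(i', j') \<in> c \<union> A" if "(k, l) \<in> c \<union> A" "i' \<le> k" "j' \<le> l" for k l i' j'
  proof (cases "(k, l) \<in> c")
    case True
    then show ?thesis
      using that is_partition_downD[OF c] by blast
  next
    case False
    then have "is_partition (insert (k, l) c)"
      using that A by (auto simp: addable_nodes_def)
    then have "(i', j') \<in> insert (k, l) c"
      using that is_partition_downD by blast
    then show ?thesis
      using that False by auto
  qed
  moreover have "finite (c \<union> A)"
    using is_partition_finite[OF c] finite_subset[OF A finite_addable_nodes[OF c \<open>i < m\<close>]] by simp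
  ultimately show ?thesis
    unfolding is_partition_def by blast
qed

text \<open>
  The last box of the last nonempty row is a corner.
\<close>

lemma nonempty_partition_has_removable:
  assumes c: "is_partition c" and "c \<noteq> {}"
  obtains b where "b \<in> removable_nodes m (residue m b) c"
proof -
  obtain r0 j0 where "(r0, j0) \<in> c"
    using assms(2) by fastforce
  then have "row_length c 0 \<noteq> 0"
    using is_partition_downD[OF c, of r0 j0 0 0] by (simp add: in_partition_iff_row_length[OF c])
  obtain N where N: "\<And>r. r \<ge> N \<Longrightarrow> row_length c r = 0"
    using row_length_eventually_zero[OF c] by blast
  define k where "k = (LEAST k. row_length c k = 0)"
  have k: "row_length c k = 0"
    unfolding k_def using N[of N] by (intro LeastI) simp
  then obtain r where r_k: "k = Suc r"
    using \<open>row_length c 0 \<noteq> 0\<close> by (cases k) auto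
  then have r: "row_length c r \<noteq> 0"
    using not_less_Least[of r "\<lambda>k. row_length c k = 0"] unfolding k_def by simp
  have "row_length c (Suc r) = 0"
    using k r_k by simp
  then have "bead c r - 1 \<notin> beads c"
    using r by (simp add: bead_pred_in_beads_iff[OF c])
  then have "(r, row_length c r - 1) \<in> c \<and> is_partition (c - {(r, row_length c r - 1)})"
    using r by (subst is_partition_remove_iff[OF c]) simp
  then have "(r, row_length c r - 1) \<in> removable_nodes m (residue m (r, row_length c r - 1)) c"
    by (simp add: removable_nodes_def)
  then show ?thesis
    by (rule that)
qed

section \<open>Cores\<close>

text \<open>
  A hook starts at the end of its row and finishes at the bottom of its column, so its length is the
  distance between the corresponding bead and gap.
\<close>

lemma hook_length_eq:
  assumes c: "is_partition c" and b: "(r, j) \<in> c"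
  shows "int (hook_length c (r, j)) = bead c r - gap c j"
proof -
  have "{j'. j < j' \<and> (r, j') \<in> c} = {j<..<row_length c r}"
    by (auto simp: in_partition_iff_row_length[OF c])
  moreover have "{r'. r < r' \<and> (r', j) \<in> c} = {r<..<col_length c j}"
    by (auto simp: in_partition_iff_col_length[OF c])
  moreover have "j < row_length c r" "r < col_length c j"
    using b in_partition_iff_row_length[OF c] in_partition_iff_col_length[OF c] by auto
  ultimately show ?thesis
    by (simp add: hook_length_def bead_def gap_def)
qed

lemma gap_less_bead_iff:
  assumes c: "is_partition c"
  shows "gap c j < bead c r \<longleftrightarrow> (r, j) \<in> c" "gap c j \<noteq> bead c r"
proof -
  have "gap c j < bead c r \<and> (r, j) \<in> c \<or> bead c r < gap c j \<and> (r, j) \<notin> c"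
  proof (cases "(r, j) \<in> c")
    case True
    then have "j < row_length c r" "r < col_length c j"
      using in_partition_iff_row_length[OF c] in_partition_iff_col_length[OF c] by auto
    then show ?thesis
      using True by (simp add: bead_def gap_def)
  next
    case False
    then have "row_length c r \<le> j" "col_length c j \<le> r"
      using in_partition_iff_row_length[OF c] in_partition_iff_col_length[OF c] by (auto simp: not_less[symmetric])
    then show ?thesis
      using False by (simp add: bead_def gap_def)
  qed
  then show "gap c j < bead c r \<longleftrightarrow> (r, j) \<in> c" "gap c j \<noteq> bead c r"
    by auto
qed

text \<open>
  Each step of the boundary path is either vertical or horizontal. To find the column that ends at a
  non-bead \<open>k\<close>, cut the diagram at the first row whose bead lies below \<open>k\<close>.
\<close>

lemma range_gap:
  assumes c: "is_partition c"
  shows "range (gap c) = - beads c"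
proof (intro equalityI subsetI)
  fix k assume "k \<in> range (gap c)"
  then show "k \<in> - beads c"
    using gap_less_bead_iff(2)[OF c] by (auto simp: beads_def)
next
  fix k assume k: "k \<in> - beads c"
  obtain N where N: "\<And>r. r \<ge> N \<Longrightarrow> row_length c r = 0"
    using row_length_eventually_zero[OF c] by blast
  define r where "r = (LEAST r. bead c r < k)"
  have "bead c (max N (nat (- k))) < k"
    using N[of "max N (nat (- k))"] by (simp add: bead_def)
  then have r: "bead c r < k"
    unfolding r_def by (rule LeastI)
  have below: "bead c s \<ge> k" if "s < r" for s
    using that not_less_Least unfolding r_def by (meson linorder_not_le)
  have above: "bead c s < k" if "r \<le> s" for s
    using that r bead_strict_antimono[OF c, of r s] by (cases "r = s") auto
  define j where "j = nat (k + int r)"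
  have j: "int j = k + int r"
    using r by (simp add: j_def bead_def)
  have "(s, j) \<in> c \<longleftrightarrow> s < r" for s
  proof
    assume "(s, j) \<in> c"
    show "s < r"
    proof (rule ccontr)
      assume "\<not> s < r"
      then have "(r, j) \<in> c"
        using \<open>(s, j) \<in> c\<close> is_partition_downD[OF c, of s j r j] by simp
      then show False
        using r j by (simp add: in_partition_iff_row_length[OF c] bead_def)
    qed
  next
    assume "s < r"
    then have "bead c (r - 1) > k"
      using below[of "r - 1"] k by (cases "bead c (r - 1) = k") auto
    then have "(r - 1, j) \<in> c"
      using j \<open>s < r\<close> by (simp add: in_partition_iff_row_length[OF c] bead_def)
    then show "(s, j) \<in> c"
      using \<open>s < r\<close> is_partition_downD[OF c, of "r - 1" j s j] by simp
  qed
  then have "gap c j = k"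
    using j by (simp add: gap_def col_length_def)
  then show "k \<in> range (gap c)"
    by blast
qed

text \<open>
  A hook of length \<open>m\<close> is a bead with a gap \<open>m\<close> places below it.
\<close>

lemma cores_iff_beads_closed:
  assumes c: "is_partition c" and "0 < m"
  shows "c \<in> cores m \<longleftrightarrow> (\<forall>x \<in> beads c. x - int m \<in> beads c)"
proof -
  have "(\<exists>b\<in>c. hook_length c b = m) \<longleftrightarrow> (\<exists>x \<in> beads c. x - int m \<notin> beads c)"
  proof
    assume "\<exists>b\<in>c. hook_length c b = m"
    then obtain r j where "(r, j) \<in> c" "hook_length c (r, j) = m"
      by (metis surj_pair)
    then have "bead c r - int m = gap c j"
      using hook_length_eq[OF c, of r j] by simp
    then have "bead c r - int m \<notin> beads c"
      using range_gap[OF c] by (metis ComplD rangeI)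
    then show "\<exists>x \<in> beads c. x - int m \<notin> beads c"
      using bead_in_beads by blast
  next
    assume "\<exists>x \<in> beads c. x - int m \<notin> beads c"
    then obtain r where "bead c r - int m \<in> - beads c"
      by (auto simp: beads_def)
    then obtain j where j: "bead c r - int m = gap c j"
      unfolding range_gap[OF c, symmetric] by blast
    then have "(r, j) \<in> c"
      using gap_less_bead_iff(1)[OF c, of j r] \<open>0 < m\<close> by simp
    moreover have "int (hook_length c (r, j)) = int m"
      using hook_length_eq[OF c \<open>(r, j) \<in> c\<close>] j by simp
    ultimately show "\<exists>b\<in>c. hook_length c b = m"
      by (metis of_nat_eq_iff)
  qed
  then show ?thesis
    using c by (auto simp: cores_def)
qed

lemma beads_core_diff_multiple:
  assumes c: "c \<in> cores m" and "0 < m" and x: "x \<in> beads c" and "y \<le> x" and "y mod int m = x mod int m"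
  shows "y \<in> beads c"
proof -
  have part: "is_partition c"
    using c by (simp add: cores_def)
  have closed: "x \<in> beads c \<Longrightarrow> x - int k * int m \<in> beads c" for k
  proof (induction k)
    case (Suc k)
    then have "x - int k * int m - int m \<in> beads c"
      using c unfolding cores_iff_beads_closed[OF part \<open>0 < m\<close>] by blast
    then show ?case
      by (simp add: algebra_simps)
  qed simp
  obtain q where q: "x - y = int m * q"
    using assms(5) by (metis mod_eq_dvd_iff dvdE)
  moreover have "q \<ge> 0"
    using q \<open>y \<le> x\<close> \<open>0 < m\<close> by (metis diff_ge_0_iff_ge of_nat_0_less_iff zero_le_mult_iff not_less)
  ultimately have "y = x - int (nat q) * int m"
    by (simp add: algebra_simps)
  then show ?thesis
    using closed[OF x] by metis
qed

text \<open>
  An addable node is a bead \<open>x\<close> with \<open>x + 1\<close> empty, a removable node is a bead \<open>y\<close> with \<open>y - 1\<close>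
  empty. If both nodes have residue \<open>i\<close>, then \<open>x + 1\<close> and \<open>y\<close> are congruent; closure under
  subtracting \<open>m\<close> fills the lower of the places \<open>x + 1\<close> and \<open>y - 1\<close>, whichever order \<open>x\<close> and
  \<open>y\<close> are in.
\<close>

lemma core_not_addable_and_removable:
  assumes c: "c \<in> cores m" and "i < m"
  shows "addable_nodes m i c = {} \<or> removable_nodes m i c = {}"
proof (rule ccontr)
  assume A: "\<not> ?thesis"
  have part: "is_partition c"
    using c by (simp add: cores_def)
  obtain r j s l where "(r, j) \<in> addable_nodes m i c" "(s, l) \<in> removable_nodes m i c"
    using A by auto
  then have x: "bead c r + 1 \<notin> beads c" "(bead c r + 1) mod int m = int i"
    and y: "bead c s - 1 \<notin> beads c" "bead c s mod int m = int i"
    by (simp_all add: addable_nodes_iff[OF part \<open>i < m\<close>] removable_nodes_iff[OF part \<open>i < m\<close>])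
  show False
  proof (cases "bead c s \<le> bead c r + 1")
    case True
    have "(bead c s - 1) mod int m = bead c r mod int m"
      using x(2) y(2) by (metis add_diff_cancel_right' mod_diff_left_eq)
    then show ?thesis
      using beads_core_diff_multiple[OF c _ bead_in_beads, of "bead c s - 1" r] True y(1) \<open>i < m\<close> by simp
  next
    case False
    then show ?thesis
      using beads_core_diff_multiple[OF c _ bead_in_beads, of "bead c r + 1" s] x y \<open>i < m\<close> by simp
  qed
qed

section \<open>Reflections of cores\<close>

lemma bead_remove_removable:
  assumes c: "is_partition c" and "i < m"
  shows "bead (c - removable_nodes m i c) r =
    bead c r - of_bool (bead c r - 1 \<notin> beads c \<and> bead c r mod int m = int i)"
proof (cases "(r, row_length c r - 1) \<in> removable_nodes m i c")
  case True
  then have rc: "0 < row_length c r"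
    by (auto simp: removable_nodes_iff[OF assms])
  have "{j. (r, j) \<in> c - removable_nodes m i c} = {j. (r, j) \<in> c} - {row_length c r - 1}"
    using True by (auto simp: removable_nodes_iff[OF assms])
  also have "\<dots> = {..<row_length c r} - {row_length c r - 1}"
    by (simp add: in_partition_iff_row_length[OF c] lessThan_def)
  finally have "row_length (c - removable_nodes m i c) r = row_length c r - 1"
    using rc by (simp add: row_length_def[of "c - _"])
  then show ?thesis
    using True rc by (auto simp: removable_nodes_iff[OF assms] bead_def[of "c - _"] bead_def[of c])
next
  case False
  then have F: "\<not> (bead c r - 1 \<notin> beads c \<and> bead c r mod int m = int i)"
  proof -
    have "row_length c r \<noteq> 0" if "bead c r - 1 \<notin> beads c"
      using that row_length_antimono[OF c, of r "Suc r"] by (auto simp: bead_pred_in_beads_iff[OF c])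
    then show ?thesis
      using False by (auto simp: removable_nodes_iff[OF assms])
  qed
  then have "{j. (r, j) \<in> c - removable_nodes m i c} = {j. (r, j) \<in> c}"
    by (auto simp: removable_nodes_iff[OF assms])
  then show ?thesis
    using F by (simp add: bead_def row_length_def)
qed

lemma bead_add_addable:
  assumes c: "is_partition c" and "i < m"
  shows "bead (c \<union> addable_nodes m i c) r =
    bead c r + of_bool (bead c r + 1 \<notin> beads c \<and> (bead c r + 1) mod int m = int i)"
proof (cases "(r, row_length c r) \<in> addable_nodes m i c")
  case True
  then have "{j. (r, j) \<in> c \<union> addable_nodes m i c} = insert (row_length c r) {..<row_length c r}"
    by (auto simp: in_partition_iff_row_length[OF c] addable_nodes_iff[OF assms])
  then have "row_length (c \<union> addable_nodes m i c) r = row_length c r + 1"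
    by (simp add: row_length_def[of "c \<union> _"])
  then show ?thesis
    using True by (auto simp: addable_nodes_iff[OF assms] bead_def[of "c \<union> _"] bead_def[of c])
next
  case False
  then have F: "\<not> (bead c r + 1 \<notin> beads c \<and> (bead c r + 1) mod int m = int i)"
    by (auto simp: addable_nodes_iff[OF assms])
  then have "{j. (r, j) \<in> c \<union> addable_nodes m i c} = {j. (r, j) \<in> c}"
    by (auto simp: addable_nodes_iff[OF assms])
  then show ?thesis
    using F by (simp add: bead_def row_length_def)
qed

text \<open>
  Removing all removable \<open>i\<close>-nodes slides every bead of residue \<open>i\<close> one place down, unless that place
  is occupied. The sliding map is compared at a bead \<open>x\<close> and at the bead \<open>x - m\<close>. The two slide alike,
  except when \<open>x\<close> moves while \<open>x - m\<close> is blocked by the bead \<open>x - m - 1\<close>; then the latter stays where it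
  is and supplies the required bead. Conversely, if \<open>x\<close> is blocked by \<open>x - 1\<close>, then so is \<open>x - m\<close>.
\<close>

lemma remove_removable_in_cores:
  assumes c: "c \<in> cores m" and "i < m" and "2 \<le> m"
  shows "c - removable_nodes m i c \<in> cores m"
proof -
  let ?d = "c - removable_nodes m i c" and ?X = "beads c"
  have part: "is_partition c" and pd: "is_partition ?d"
    using c is_partition_remove_removable[of c] by (auto simp: cores_def)
  have closed: "\<And>x. x \<in> ?X \<Longrightarrow> x - int m \<in> ?X"
    using c cores_iff_beads_closed[OF part] \<open>2 \<le> m\<close> by auto
  define slide where "slide x = x - of_bool (x - 1 \<notin> ?X \<and> x mod int m = int i)" for x
  have bd: "beads ?d = slide ` ?X"
    by (auto simp: beads_def slide_def bead_remove_removable[OF part \<open>i < m\<close>])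
  have shift: "(x - int m) mod int m = x mod int m" for x :: int
    by simp
  have ne: "(x - 1) mod int m \<noteq> x mod int m" for x :: int
    using \<open>2 \<le> m\<close> by (auto simp: mod_eq_dvd_iff)
  have "slide x - int m \<in> slide ` ?X" if x: "x \<in> ?X" for x
  proof (cases "x mod int m = int i")
    case False
    then have "slide (x - int m) = slide x - int m"
      by (simp add: slide_def)
    then show ?thesis
      using closed[OF x] by (metis imageI)
  next
    case True
    show ?thesis
    proof (cases "x - int m - 1 \<in> ?X")
      case in_X: True
      show ?thesis
      proof (cases "x - 1 \<in> ?X")
        case True
        then have "slide (x - int m) = slide x - int m"
          using in_X by (simp add: slide_def)
        then show ?thesis
          using closed[OF x] by (metis imageI)
      next
        case out: False
        have "slide (x - int m - 1) = slide x - int m"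
          using True out ne[of x] shift[of "x - 1"] by (auto simp: slide_def algebra_simps)
        then show ?thesis
          using in_X by (metis imageI)
      qed
    next
      case out: False
      then have "x - 1 \<notin> ?X"
        using closed[of "x - 1"] by (auto simp: algebra_simps)
      then have "slide (x - int m) = slide x - int m"
        using out True by (simp add: slide_def)
      then show ?thesis
        using closed[OF x] by (metis imageI)
    qed
  qed
  then show ?thesis
    using \<open>2 \<le> m\<close> by (subst cores_iff_beads_closed[OF pd]) (auto simp: bd)
qed

text \<open>
  The mirror image of \<open>remove_removable_in_cores\<close>: beads slide upwards, and the bead that stays is
  \<open>x - m + 1\<close>.
\<close>

lemma add_addable_in_cores:
  assumes c: "c \<in> cores m" and "i < m" and "2 \<le> m"
  shows "c \<union> addable_nodes m i c \<in> cores m"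
proof -
  let ?d = "c \<union> addable_nodes m i c" and ?X = "beads c"
  have part: "is_partition c" and pd: "is_partition ?d"
    using c is_partition_add_addable[of c] \<open>i < m\<close> by (auto simp: cores_def)
  have closed: "\<And>x. x \<in> ?X \<Longrightarrow> x - int m \<in> ?X"
    using c cores_iff_beads_closed[OF part] \<open>2 \<le> m\<close> by auto
  define slide where "slide x = x + of_bool (x + 1 \<notin> ?X \<and> (x + 1) mod int m = int i)" for x
  have bd: "beads ?d = slide ` ?X"
    by (auto simp: beads_def slide_def bead_add_addable[OF part \<open>i < m\<close>])
  have shift: "(x - int m + 1) mod int m = (x + 1) mod int m" for x :: int
    by (metis add.commute add_diff_eq minus_mod_self2)
  have ne: "(x + 1) mod int m \<noteq> x mod int m" for x :: int
    using \<open>2 \<le> m\<close> by (auto simp: mod_eq_dvd_iff)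
  have "slide x - int m \<in> slide ` ?X" if x: "x \<in> ?X" for x
  proof (cases "(x + 1) mod int m = int i")
    case False
    then have "slide (x - int m) = slide x - int m"
      by (simp add: slide_def shift)
    then show ?thesis
      using closed[OF x] by (metis imageI)
  next
    case True
    show ?thesis
    proof (cases "x - int m + 1 \<in> ?X")
      case in_X: True
      show ?thesis
      proof (cases "x + 1 \<in> ?X")
        case True
        then have "slide (x - int m) = slide x - int m"
          using in_X by (simp add: slide_def)
        then show ?thesis
          using closed[OF x] by (metis imageI)
      next
        case out: False
        have "slide (x - int m + 1) = slide x - int m"
          using True out ne[of "x + 1"] shift[of "x + 1"] by (auto simp: slide_def algebra_simps)
        then show ?thesis
          using in_X by (metis imageI)
      qed
    next
      case out: False
      then have "x + 1 \<notin> ?X"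
        using closed[of "x + 1"] by (auto simp: algebra_simps)
      then have "slide (x - int m) = slide x - int m"
        using out True by (simp add: slide_def shift)
      then show ?thesis
        using closed[OF x] by (metis imageI)
    qed
  qed
  then show ?thesis
    using \<open>2 \<le> m\<close> by (subst cores_iff_beads_closed[OF pd]) (auto simp: bd)
qed

lemma core_reflection_in_cores:
  assumes "c \<in> cores m" "i < m" "2 \<le> m"
  shows "core_reflection m i c \<in> cores m"
  using assms remove_removable_in_cores add_addable_in_cores by (simp add: core_reflection_def)

text \<open>
  After the removable \<open>i\<close>-nodes have been removed they are addable. There are no further addable
  \<open>i\<close>-nodes: a union of partitions is a partition, so such a node would already be addable to \<open>c\<close>,
  next to a removable one. When nodes are added, intersections play this part.
\<close>

lemma core_reflection_involution:
  assumes c: "c \<in> cores m" and "i < m" and "2 \<le> m"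
  shows "core_reflection m i (core_reflection m i c) = c"
proof -
  have part: "is_partition c"
    using c by (simp add: cores_def)
  let ?R = "removable_nodes m i c" and ?A = "addable_nodes m i c"
  consider "?R \<noteq> {}" "?A = {}" | "?R = {}" "?A \<noteq> {}" | "?R = {}" "?A = {}"
    using core_not_addable_and_removable[OF c \<open>i < m\<close>] by blast
  then show ?thesis
  proof cases
    case 1
    let ?d = "c - ?R"
    have d: "?d \<in> cores m"
      using remove_removable_in_cores[OF assms] .
    have "addable_nodes m i ?d = ?R"
    proof (intro equalityI subsetI)
      fix b assume b: "b \<in> ?R"
      have "insert b ?d = c - (?R - {b})"
        using b removable_nodes_subset by auto
      then have "is_partition (insert b ?d)"
        using is_partition_remove_removable[OF part, of "?R - {b}"] by auto
      then show "b \<in> addable_nodes m i ?d"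
        using b by (auto simp: addable_nodes_def removable_nodes_def)
    next
      fix b assume b: "b \<in> addable_nodes m i ?d"
      have "insert b c = insert b ?d \<union> c"
        by auto
      then have "is_partition (insert b c)"
        using b is_partition_Un[of "insert b ?d" c] part by (simp add: addable_nodes_def)
      then have "b \<in> c"
        using 1(2) b unfolding addable_nodes_def by blast
      then show "b \<in> ?R"
        using b by (auto simp: addable_nodes_def)
    qed
    then have "removable_nodes m i ?d = {}" "?d \<union> addable_nodes m i ?d = c"
      using 1 core_not_addable_and_removable[OF d \<open>i < m\<close>] removable_nodes_subset[of m i c] by auto
    then show ?thesis
      using 1 \<open>addable_nodes m i ?d = ?R\<close> by (simp add: core_reflection_def)
  next
    case 2
    let ?d = "c \<union> ?A"
    have "removable_nodes m i ?d = ?A"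
    proof (intro equalityI subsetI)
      fix b assume b: "b \<in> ?A"
      have "?d - {b} = c \<union> (?A - {b})"
        using b addable_nodes_disjoint by auto
      then have "is_partition (?d - {b})"
        using is_partition_add_addable[OF part \<open>i < m\<close>, of "?A - {b}"] by auto
      then show "b \<in> removable_nodes m i ?d"
        using b by (auto simp: addable_nodes_def removable_nodes_def)
    next
      fix b assume b: "b \<in> removable_nodes m i ?d"
      have "c - {b} = (?d - {b}) \<inter> c"
        by auto
      then have "is_partition (c - {b})"
        using b is_partition_Int[of "?d - {b}" c] part by (simp add: removable_nodes_def)
      then have "b \<notin> c"
        using 2(1) b unfolding removable_nodes_def by blast
      then show "b \<in> ?A"
        using b by (auto simp: removable_nodes_def)
    qed
    then show ?thesis
      using 2 addable_nodes_disjoint[of m i c] by (auto simp: core_reflection_def)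
  next
    case 3
    then show ?thesis
      by (simp add: core_reflection_def)
  qed
qed

section \<open>The weight of a partition\<close>

lemma lookup_scaleR_weight:
  fixes x :: weight
  shows "Poly_Mapping.lookup (a *\<^sub>R x) k = a * Poly_Mapping.lookup x k"
proof -
  have "finite {i. a * Poly_Mapping.lookup x i \<noteq> 0}"
    by (rule finite_subset[OF _ finite_lookup[of x]]) auto
  then show ?thesis
    by (simp add: scaleR_poly_mapping_def Abs_poly_mapping_inverse)
qed

lemma pairing_linear [simp]:
  "pairing 0 i = 0"
  "pairing (x + y) i = pairing x i + pairing y i"
  "pairing (x - y) i = pairing x i - pairing y i"
  "pairing (a *\<^sub>R x) i = a * pairing x i"
  "pairing (sum g S) i = (\<Sum>s\<in>S. pairing (g s) i)"
  by (simp_all add: pairing_def lookup_add lookup_minus lookup_scaleR_weight lookup_sum)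

lemma pairing_fund_weight [simp]: "pairing (fund_weight k) i = of_bool (k = i)"
  by (simp add: pairing_def fund_weight_def lookup_single)

lemma pairing_null_root [simp]: "pairing null_root i = 0"
  by (simp add: pairing_def null_root_def lookup_single)

lemma pairing_simple_root:
  assumes "j < m"
  shows "pairing (simple_root m i) j = cartan m j i"
  using assms by (simp add: simple_root_def of_bool_def if_distrib[of "\<lambda>x. _ * x"] cong: if_cong)

lemma lookup_Delta_simple_root: "Poly_Mapping.lookup (simple_root m i) Delta = of_bool (i = 0)"
  by (simp add: simple_root_def lookup_add lookup_sum lookup_scaleR_weight fund_weight_def
      null_root_def lookup_single)

definition partition_weight :: "nat \<Rightarrow> box set \<Rightarrow> weight" where
  "partition_weight m c = fund_weight 0 - (\<Sum>b\<in>c. simple_root m (residue m b))"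

lemma partition_weight_empty [simp]: "partition_weight m {} = fund_weight 0"
  by (simp add: partition_weight_def)

lemma mod_eq_int_iff_dvd: "i < m \<Longrightarrow> k mod int m = int i \<longleftrightarrow> int m dvd k - int i"
  by (metis mod_eq_dvd_iff mod_pos_pos_trivial of_nat_0_le_iff of_nat_less_iff)

text \<open>
  The row \<open>i\<close> of the Cartan matrix is a second difference of the indicator of the residue class of \<open>i\<close>. This is
  what makes its sums along rows of a diagram telescope.
\<close>

lemma cartan_residue:
  fixes m i r j :: nat
  defines "f \<equiv> \<lambda>k. of_bool (k mod int m = int i) :: real"
  defines "k \<equiv> int j - int r"
  assumes "3 \<le> m" "i < m"
  shows "cartan m i (residue m (r, j)) = 2 * f k - f (k - 1) - f (k + 1)"
proof -
  define q where "q = residue m (r, j)"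
  have q: "int q = k mod int m"
    using assms by (simp add: q_def residue_def k_def)
  have m: "\<not> int m dvd 1" "\<not> int m dvd 2"
    using \<open>3 \<le> m\<close> by (auto dest: zdvd_imp_le)
  have f: "f x = of_bool (int m dvd x - int i)" for x
    using mod_eq_int_iff_dvd[OF \<open>i < m\<close>] by (simp add: f_def)
  have 0: "i = q \<longleftrightarrow> int m dvd k - int i"
    using q mod_eq_int_iff_dvd[OF \<open>i < m\<close>, of k] by auto
  have "int (Suc i mod m) = (int i + 1) mod int m"
    by (simp add: zmod_int add.commute)
  then have "Suc i mod m = q \<longleftrightarrow> (int i + 1) mod int m = k mod int m"
    using q by (metis of_nat_eq_iff)
  also have "\<dots> \<longleftrightarrow> int m dvd k - 1 - int i"
    by (metis (no_types, opaque_lifting) mod_eq_dvd_iff add.commute diff_diff_eq)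
  finally have 1: "Suc i mod m = q \<longleftrightarrow> int m dvd k - 1 - int i" .
  have "int (Suc q mod m) = (k + 1) mod int m"
    using q by (simp add: zmod_int add.commute mod_add_right_eq)
  then have 2: "Suc q mod m = i \<longleftrightarrow> int m dvd k + 1 - int i"
    using mod_eq_int_iff_dvd[OF \<open>i < m\<close>, of "k + 1"] by (metis of_nat_eq_iff)
  have excl: "\<not> (int m dvd k - int i \<and> int m dvd k - 1 - int i)"
    "\<not> (int m dvd k - int i \<and> int m dvd k + 1 - int i)"
    "\<not> (int m dvd k - 1 - int i \<and> int m dvd k + 1 - int i)"
    using m dvd_diff[of "int m" "k - int i" "k - 1 - int i"]
      dvd_diff[of "int m" "k + 1 - int i" "k - int i"]
      dvd_diff[of "int m" "k + 1 - int i" "k - 1 - int i"] by auto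
  show ?thesis
    unfolding q_def[symmetric] cartan_def f 0 1 2 using excl by auto
qed

text \<open>
  With \<open>f\<close> the indicator of the residue class of \<open>i\<close> and \<open>x\<^sub>r\<close> the bead of row \<open>r\<close>, the sum of Cartan
  integers along row \<open>r\<close> telescopes to a difference at its left end, which telescopes again over the
  rows, and the difference \<open>f x\<^sub>r - f (x\<^sub>r + 1)\<close> at its right end. In the sum of the latter over all
  rows, \<open>f x\<^sub>r\<close> cancels against \<open>f (x\<^bsub>r+1\<^esub> + 1)\<close> whenever rows \<open>r\<close> and \<open>r + 1\<close> have equal length.
  What survives are the places where rows can be shortened or extended.
\<close>

lemma card_addable_minus_card_removable:
  assumes c: "is_partition c" and "3 \<le> m" "i < m"
  shows "real (card (addable_nodes m i c)) - real (card (removable_nodes m i c)) =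
    of_bool (i = 0) - (\<Sum>b\<in>c. cartan m i (residue m b))"
proof -
  obtain N where N: "\<And>r. r \<ge> N \<Longrightarrow> row_length c r = 0"
    using row_length_eventually_zero[OF c] by blast
  define f :: "int \<Rightarrow> real" where "f k = of_bool (k mod int m = int i)" for k
  define R :: "nat \<Rightarrow> real" where "R r = of_bool (bead c r - 1 \<notin> beads c)" for r
  define A :: "nat \<Rightarrow> real" where "A r = of_bool (bead c r + 1 \<notin> beads c)" for r
  have A_0: "A 0 = 1"
    by (simp add: A_def bead_succ_in_beads_iff[OF c])
  have A_Suc: "A (Suc r) = R r" for r
    by (simp add: A_def R_def bead_succ_in_beads_iff[OF c] bead_pred_in_beads_iff[OF c])
  have R_N: "R r = 0" if "r \<ge> N" for r
    using that N by (simp add: R_def bead_pred_in_beads_iff[OF c])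
  have "addable_nodes m i c = (\<lambda>r. (r, row_length c r)) `
    ({..<Suc N} \<inter> {r. bead c r + 1 \<notin> beads c \<and> (bead c r + 1) mod int m = int i})"
  proof -
    have "r < Suc N" if "bead c r + 1 \<notin> beads c" for r
    proof (rule ccontr)
      assume "\<not> r < Suc N"
      then have "A r = 0"
        using A_Suc[of "r - 1"] R_N[of "r - 1"] by simp
      then show False
        using that by (simp add: A_def)
    qed
    then show ?thesis
      by (auto simp: addable_nodes_iff[OF c \<open>i < m\<close>])
  qed
  then have "card (addable_nodes m i c) =
    card ({..<Suc N} \<inter> {r. bead c r + 1 \<notin> beads c \<and> (bead c r + 1) mod int m = int i})"
    by (simp add: card_image inj_on_def)
  then have add: "real (card (addable_nodes m i c)) = (\<Sum>r<Suc N. f (bead c r + 1) * A r)"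
    unfolding f_def A_def of_bool_conj[symmetric]
    by (subst sum_of_bool_eq) (simp_all add: conj_commute)
  have "removable_nodes m i c = (\<lambda>r. (r, row_length c r - 1)) `
    ({..<Suc N} \<inter> {r. bead c r - 1 \<notin> beads c \<and> bead c r mod int m = int i})"
  proof -
    have "r < Suc N" "row_length c r \<noteq> 0" if "bead c r - 1 \<notin> beads c" for r
      using that R_N[of r] row_length_antimono[OF c, of r "Suc r"]
      by (cases "r < N"; auto simp: R_def bead_pred_in_beads_iff[OF c])+
    then show ?thesis
      by (force simp: removable_nodes_iff[OF c \<open>i < m\<close>])
  qed
  then have "card (removable_nodes m i c) =
    card ({..<Suc N} \<inter> {r. bead c r - 1 \<notin> beads c \<and> bead c r mod int m = int i})"
    by (simp add: card_image inj_on_def)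
  then have rem: "real (card (removable_nodes m i c)) = (\<Sum>r<Suc N. f (bead c r) * R r)"
    unfolding f_def R_def of_bool_conj[symmetric]
    by (subst sum_of_bool_eq) (simp_all add: conj_commute)
  \<comment> \<open>rows r and r + 1 of equal length contribute nothing, so the factor R r can be dropped\<close>
  have step: "(f (bead c (Suc r) + 1) - f (bead c r)) * R r = f (bead c (Suc r) + 1) - f (bead c r)" for r
  proof (cases "bead c r - 1 \<in> beads c")
    case True
    then have "row_length c (Suc r) = row_length c r"
      by (simp add: bead_pred_in_beads_iff[OF c])
    then have "bead c (Suc r) + 1 = bead c r"
      by (simp add: bead_def)
    then show ?thesis by simp
  qed (simp add: R_def)
  have "real (card (addable_nodes m i c)) - real (card (removable_nodes m i c)) =
    f (bead c 0 + 1) + (\<Sum>r<N. f (bead c (Suc r) + 1) * R r) - (\<Sum>r<N. f (bead c r) * R r)"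
    unfolding add rem sum.lessThan_Suc_shift[of "\<lambda>r. f (bead c r + 1) * A r"]
    by (simp add: A_0 A_Suc R_N)
  also have "\<dots> = f (bead c 0 + 1) + (\<Sum>r<N. (f (bead c (Suc r) + 1) - f (bead c r)) * R r)"
    by (simp add: left_diff_distrib sum_subtractf)
  also have "\<dots> = (\<Sum>r<Suc N. f (bead c r + 1)) - (\<Sum>r<Suc N. f (bead c r)) + f (bead c N)"
    unfolding step sum.lessThan_Suc_shift[of "\<lambda>r. f (bead c r + 1)"] by (simp add: sum_subtractf)
  finally have LHS: "real (card (addable_nodes m i c)) - real (card (removable_nodes m i c)) =
    (\<Sum>r<Suc N. f (bead c r + 1)) - (\<Sum>r<Suc N. f (bead c r)) + f (bead c N)" .
  have row: "(\<Sum>j<L. cartan m i (residue m (r, j))) =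
    f (- int r) - f (- int r - 1) - f (int L - int r) + f (int L - int r - 1)" for L r
  proof (induction L)
    case (Suc L)
    then show ?case
      unfolding sum.lessThan_Suc cartan_residue[OF \<open>3 \<le> m\<close> \<open>i < m\<close>] f_def[symmetric]
      by (simp add: algebra_simps)
  qed simp
  have "c = Sigma {..<Suc N} (\<lambda>r. {..<row_length c r})"
  proof -
    have "r < N" if "(r, j) \<in> c" for r j
      using that N[of r] by (cases "r < N") (simp_all add: in_partition_iff_row_length[OF c])
    then have "r < Suc N" if "(r, j) \<in> c" for r j
      using that less_SucI by blast
    then show ?thesis
      using in_partition_iff_row_length[OF c] by auto
  qed
  then have "(\<Sum>b\<in>c. cartan m i (residue m b)) =
    (\<Sum>r<Suc N. \<Sum>j<row_length c r. cartan m i (residue m (r, j)))"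
    by (metis (no_types, lifting) sum.Sigma finite_lessThan sum.cong case_prod_conv prod.collapse
        split_conv case_prod_beta)
  also have "\<dots> = (\<Sum>r<Suc N. f (- int r) - f (- int (Suc r)) - f (bead c r + 1) + f (bead c r))"
    unfolding row by (intro sum.cong arg_cong2[of _ _ _ _ "(+)"] arg_cong2[of _ _ _ _ "(-)"] arg_cong[of _ _ f])
      (simp_all add: bead_def)
  also have "\<dots> = (\<Sum>r<Suc N. f (- int r) - f (- int (Suc r))) - (\<Sum>r<Suc N. f (bead c r + 1))
      + (\<Sum>r<Suc N. f (bead c r))"
    by (simp add: sum.distrib sum_subtractf)
  also have "(\<Sum>r<Suc N. f (- int r) - f (- int (Suc r))) = f 0 - f (- int (Suc N))"
    by (subst sum_lessThan_telescope') simp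
  also have "- int (Suc N) = bead c N"
    using N by (simp add: bead_def)
  also have "f 0 = of_bool (i = 0)"
    by (simp add: f_def)
  finally show ?thesis
    unfolding LHS by simp
qed

lemma pairing_partition_weight:
  assumes "is_partition c" "3 \<le> m" "i < m"
  shows "pairing (partition_weight m c) i =
    real (card (addable_nodes m i c)) - real (card (removable_nodes m i c))"
  unfolding card_addable_minus_card_removable[OF assms]
  using \<open>i < m\<close> by (auto simp: partition_weight_def pairing_simple_root)

text \<open>
  A core has only one kind of \<open>i\<close>-nodes, addable or removable, so the pairing is, up to sign, the number
  of boxes that the reflection moves.
\<close>

lemma partition_weight_core_reflection:
  assumes c: "c \<in> cores m" and "3 \<le> m" "i < m"
  shows "partition_weight m (core_reflection m i c) = reflection m i (partition_weight m c)"
proof -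
  let ?R = "removable_nodes m i c" and ?A = "addable_nodes m i c"
  have part: "is_partition c"
    using c by (simp add: cores_def)
  note pair = pairing_partition_weight[OF part \<open>3 \<le> m\<close> \<open>i < m\<close>]
  have fin: "finite c" "finite ?A"
    using is_partition_finite[OF part] finite_addable_nodes[OF part \<open>i < m\<close>] by auto
  have R: "(\<Sum>b\<in>?R. simple_root m (residue m b)) = real (card ?R) *\<^sub>R simple_root m i"
    by (simp add: removable_nodes_def sum_constant_scaleR)
  have A: "(\<Sum>b\<in>?A. simple_root m (residue m b)) = real (card ?A) *\<^sub>R simple_root m i"
    by (simp add: addable_nodes_def sum_constant_scaleR)
  consider "?R \<noteq> {}" "?A = {}" | "?R = {}" "?A \<noteq> {}" | "?R = {}" "?A = {}"
    using core_not_addable_and_removable[OF c \<open>i < m\<close>] by blast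
  then show ?thesis
  proof cases
    case 1
    then show ?thesis
      using R by (simp add: core_reflection_def partition_weight_def[of m "_ - _"] reflection_def pair
          sum_diff[OF fin(1) removable_nodes_subset]) (simp add: partition_weight_def)
  next
    case 2
    have "c \<inter> ?A = {}"
      using addable_nodes_disjoint by blast
    then show ?thesis
      using 2 A by (simp add: core_reflection_def partition_weight_def[of m "_ \<union> _"] reflection_def pair
          sum.union_disjoint[OF fin]) (simp add: partition_weight_def)
  next
    case 3
    then show ?thesis
      by (simp add: core_reflection_def reflection_def pair)
  qed
qed

text \<open>
  The null root enters only \<open>\<alpha>\<^sub>0\<close>, so a vanishing combination has coefficient \<open>0\<close> at \<open>\<alpha>\<^sub>0\<close>. The
  pairings with the other coroots say that the coefficients form an arithmetic progression along
  \<open>0, 1, \<dots>, m\<close>, and it vanishes at both ends because \<open>m\<close> closes up with \<open>0\<close>.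
\<close>

lemma simple_roots_independent:
  fixes a b :: "nat \<Rightarrow> real"
  assumes "3 \<le> m"
    and eq: "(\<Sum>j<m. a j *\<^sub>R simple_root m j) = (\<Sum>j<m. b j *\<^sub>R simple_root m j)"
    and "j < m"
  shows "a j = b j"
proof -
  \<comment> \<open>the value 0 at m agrees with d 0 = 0, so the recurrence needs no reduction modulo m\<close>
  define d where "d j = (if j < m then a j - b j else 0)" for j
  have "(\<Sum>j<m. d j *\<^sub>R simple_root m j) = (\<Sum>j<m. (a j - b j) *\<^sub>R simple_root m j)"
    by (simp add: d_def)
  also have "\<dots> = 0"
    using eq by (simp add: scaleR_left_diff_distrib sum_subtractf)
  finally have zero: "(\<Sum>j<m. d j *\<^sub>R simple_root m j) = 0" .
  have "0 = Poly_Mapping.lookup (\<Sum>j<m. d j *\<^sub>R simple_root m j) Delta"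
    by (simp add: zero)
  also have "\<dots> = (\<Sum>j<m. if j = 0 then d j else 0)"
    by (auto simp: lookup_sum lookup_scaleR_weight lookup_Delta_simple_root intro: sum.cong)
  also have "\<dots> = d 0"
    using \<open>3 \<le> m\<close> by simp
  finally have d_0: "d 0 = 0" by simp
  have d_m: "d m = 0"
    by (simp add: d_def)
  have rec: "d (Suc (Suc j)) = 2 * d (Suc j) - d j" if j: "Suc j < m" for j
  proof -
    have "cartan m (Suc j) k = 2 * of_bool (k = Suc j) - of_bool (k = Suc (Suc j) mod m) - of_bool (k = j)"
      if "k < m" for k
      using that j \<open>3 \<le> m\<close> by (auto simp: cartan_def mod_Suc)
    then have "pairing (\<Sum>k<m. d k *\<^sub>R simple_root m k) (Suc j) = 
      (\<Sum>k<m. 2 * (if k = Suc j then d k else 0) - (if k = Suc (Suc j) mod m then d k else 0)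
         - (if k = j then d k else 0))"
      using j by (auto simp: pairing_simple_root intro!: sum.cong)
    also have "\<dots> = 2 * d (Suc j) - d (Suc (Suc j) mod m) - d j"
      using j by (simp add: sum_subtractf sum_distrib_left[symmetric])
    also have "d (Suc (Suc j) mod m) = d (Suc (Suc j))"
      using j d_0 d_m by (auto simp: mod_Suc)
    finally show ?thesis
      by (simp add: zero)
  qed
  have lin: "d k = real k * d 1 \<and> (Suc k \<le> m \<longrightarrow> d (Suc k) = real (Suc k) * d 1)" if "k \<le> m" for k
    using that
  proof (induction k)
    case 0
    then show ?case using d_0 by simp
  next
    case (Suc k)
    then show ?case
      using rec[of k] by (auto simp: algebra_simps)
  qed
  have "d 1 = 0"
    using lin[of m] d_m \<open>3 \<le> m\<close> by simp
  then have "d j = 0"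
    using lin[of j] \<open>j < m\<close> by simp
  then show ?thesis
    using \<open>j < m\<close> by (simp add: d_def)
qed

lemma sum_simple_root_residue:
  assumes "finite c" "0 < m"
  shows "(\<Sum>b\<in>c. simple_root m (residue m b)) = (\<Sum>j<m. real (num_nodes m j c) *\<^sub>R simple_root m j)"
proof -
  have "(\<Sum>b\<in>c. simple_root m (residue m b)) =
    (\<Sum>j<m. \<Sum>b\<in>{b\<in>c. residue m b = j}. simple_root m (residue m b))"
    using assms by (intro sum.group[symmetric]) (auto simp: residue_less)
  also have "\<dots> = (\<Sum>j<m. real (num_nodes m j c) *\<^sub>R simple_root m j)"
    by (intro sum.cong) (simp_all add: num_nodes_def sum_constant_scaleR)
  finally show ?thesis .
qed

lemma card_eq_sum_num_nodes:
  assumes "finite c" "0 < m"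
  shows "card c = (\<Sum>j<m. num_nodes m j c)"
proof -
  have "(\<Sum>b\<in>c. 1) = (\<Sum>j<m. \<Sum>b\<in>{b\<in>c. residue m b = j}. 1::nat)"
    using assms by (intro sum.group[symmetric]) (auto simp: residue_less)
  then show ?thesis
    by (simp add: num_nodes_def)
qed

lemma pairing_neg_iff_removable:
  assumes c: "c \<in> cores m" and "3 \<le> m" "i < m"
  shows "pairing (partition_weight m c) i < 0 \<longleftrightarrow> removable_nodes m i c \<noteq> {}"
proof -
  have part: "is_partition c"
    using c by (simp add: cores_def)
  show ?thesis
    using core_not_addable_and_removable[OF c \<open>i < m\<close>] finite_removable_nodes[OF part, of m i]
    by (auto simp: pairing_partition_weight[OF part assms(2,3)] card_gt_0_iff)
qed

lemma card_core_reflection_less: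
  assumes "is_partition c" and "removable_nodes m i c \<noteq> {}"
  shows "card (core_reflection m i c) < card c"
proof -
  have "core_reflection m i c = c - removable_nodes m i c"
    using assms(2) by (simp add: core_reflection_def)
  also have "\<dots> \<subset> c"
    using assms(2) removable_nodes_subset[of m i c] by blast
  finally show ?thesis
    using is_partition_finite[OF assms(1)] by (simp add: psubset_card_mono)
qed

lemma partition_weight_eq_fund_weight:
  assumes "finite c" "3 \<le> m" "partition_weight m c = fund_weight 0"
  shows "c = {}"
proof -
  have "(\<Sum>j<m. real (num_nodes m j c) *\<^sub>R simple_root m j) = (\<Sum>j<m. 0 *\<^sub>R simple_root m j)"
    using assms sum_simple_root_residue[OF assms(1), of m] by (simp add: partition_weight_def)
  then have "num_nodes m j c = 0" if "j < m" for j
    using simple_roots_independent[OF \<open>3 \<le> m\<close>, of "\<lambda>j. real (num_nodes m j c)" "\<lambda>j. 0" j] that by simp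
  then have "card c = 0"
    using assms card_eq_sum_num_nodes[OF assms(1), of m] by simp
  then show ?thesis
    using assms(1) by simp
qed

text \<open>
  Induction on the number of boxes of \<open>c\<close>: a removable \<open>i\<close>-node of \<open>c\<close> makes the \<open>i\<close>-th pairing negative,
  so \<open>s\<^sub>i\<close> maps both cores to cores of equal weight, the first one smaller. Being an involution,
  \<open>s\<^sub>i\<close> can be undone. The empty core is the only one of weight \<open>\<Lambda>\<^sub>0\<close> by linear independence of
  the simple roots.
\<close>

lemma partition_weight_inj_on_cores:
  assumes "3 \<le> m" "c \<in> cores m" "d \<in> cores m" "partition_weight m c = partition_weight m d"
  shows "c = d"
  using assms(2-)
proof (induction "card c" arbitrary: c d rule: less_induct)
  case less
  have part: "is_partition c" "is_partition d"
    using less.prems by (auto simp: cores_def)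
  show ?case
  proof (cases "c = {}")
    case True
    then show ?thesis
      using partition_weight_eq_fund_weight[OF is_partition_finite[OF part(2)] \<open>3 \<le> m\<close>] less.prems by simp
  next
    case False
    then obtain b where b: "b \<in> removable_nodes m (residue m b) c"
      using nonempty_partition_has_removable[OF part(1)] by blast
    define i where "i = residue m b"
    have i: "i < m" "removable_nodes m i c \<noteq> {}"
      using b residue_less[of m b] \<open>3 \<le> m\<close> by (auto simp: i_def)
    let ?s = "core_reflection m i"
    have "partition_weight m (?s c) = partition_weight m (?s d)"
      using less.prems i \<open>3 \<le> m\<close> by (simp add: partition_weight_core_reflection)
    then have "?s c = ?s d"
      using less.hyps[of "?s c" "?s d"] card_core_reflection_less[OF part(1) i(2)]
        core_reflection_in_cores less.prems i(1) \<open>3 \<le> m\<close> by simp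
    then have "?s (?s c) = ?s (?s d)" by simp
    then show ?thesis
      using core_reflection_involution less.prems i(1) \<open>3 \<le> m\<close> by simp
  qed
qed

section \<open>The Weyl group action on cores\<close>

lemma empty_in_cores [simp]: "{} \<in> cores m"
  by (simp add: cores_def)

lemma foldr_core_reflection:
  assumes "3 \<le> m" "is \<in> lists {..<m}"
  shows "foldr (core_reflection m) is {} \<in> cores m"
    and "partition_weight m (foldr (core_reflection m) is {}) = foldr (reflection m) is (fund_weight 0)"
  using assms(2)
  by (induction "is") (use \<open>3 \<le> m\<close> in \<open>auto simp: core_reflection_in_cores partition_weight_core_reflection\<close>)

text \<open>
  Two words for the same group element give cores of the same weight, hence the same core. So the definite
  description in \<open>core_action\<close> denotes, and weights decide its value.
\<close>

lemma core_action_empty_eq_iff: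
  assumes "3 \<le> m" "is \<in> lists {..<m}" "c \<in> cores m"
  shows "core_action m (foldr (reflection m) is) {} = c \<longleftrightarrow>
    foldr (reflection m) is (fund_weight 0) = partition_weight m c"
proof -
  have "core_action m (foldr (reflection m) is) {} = foldr (core_reflection m) is {}"
    unfolding core_action_def
  proof (rule the_equality)
    show "\<exists>js\<in>lists {..<m}. foldr (reflection m) is = foldr (reflection m) js \<and>
        foldr (core_reflection m) is {} = foldr (core_reflection m) js {}"
      using assms(2) by blast
  next
    fix d assume "\<exists>js\<in>lists {..<m}. foldr (reflection m) is = foldr (reflection m) js \<and>
        d = foldr (core_reflection m) js {}"
    then show "d = foldr (core_reflection m) is {}"
      using foldr_core_reflection[OF \<open>3 \<le> m\<close>] assms(2)
      by (metis partition_weight_inj_on_cores[OF \<open>3 \<le> m\<close>])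
  qed
  then show ?thesis
    using foldr_core_reflection[OF assms(1,2)] partition_weight_inj_on_cores[OF assms(1) _ assms(3)] by metis
qed

lemma reflection_reflection:
  assumes "i < m"
  shows "reflection m i (reflection m i x) = x"
  using assms by (simp add: reflection_def pairing_simple_root cartan_def algebra_simps scaleR_left_diff_distrib[symmetric])

lemma reflection_commute:
  assumes "i < m" "j < m" "cartan m i j = 0" "cartan m j i = 0"
  shows "reflection m i (reflection m j x) = reflection m j (reflection m i x)"
  using assms by (simp add: reflection_def pairing_simple_root)

section \<open>Conjugation\<close>

lemma is_partition_swap [simp]: "is_partition (prod.swap ` c) \<longleftrightarrow> is_partition c"
proof -
  have "is_partition (prod.swap ` c)" if "is_partition c" for c
    unfolding is_partition_def
  proof (intro conjI allI impI)
    show "finite (prod.swap ` c)"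
      using is_partition_finite[OF that] by simp
    fix i j i' j' assume "(i, j) \<in> prod.swap ` c" "i' \<le> i" "j' \<le> j"
    then have "(j', i') \<in> c"
      using is_partition_downD[OF that, of j i j' i'] by auto
    then show "(i', j') \<in> prod.swap ` c"
      by (metis image_eqI swap_simp)
  qed
  from this[of c] this[of "prod.swap ` c"] show ?thesis
    by (auto simp: image_comp)
qed

lemma residue_swap:
  assumes "i < m"
  shows "residue m (prod.swap b) = i \<longleftrightarrow> residue m b = (m - i) mod m"
proof -
  obtain r j where b: "b = (r, j)" by fastforce
  have "int ((m - i) mod m) = (- int i) mod int m"
    using assms by (simp add: zmod_int of_nat_diff)
  then have "residue m b = (m - i) mod m \<longleftrightarrow> (int j - int r) mod int m = (- int i) mod int m"
    using assms residue_eq_iff[of "(m - i) mod m" m r j] by (simp add: b)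
  also have "\<dots> \<longleftrightarrow> int m dvd - (int r - int j - int i)"
    by (simp add: mod_eq_dvd_iff algebra_simps)
  also have "\<dots> \<longleftrightarrow> residue m (prod.swap b) = i"
    using assms by (simp only: dvd_minus_iff b swap_simp residue_eq_iff[OF assms] mod_eq_int_iff_dvd[OF assms])
  finally show ?thesis by simp
qed

lemma swap_image_mem [simp]: "prod.swap b \<in> prod.swap ` c \<longleftrightarrow> b \<in> c"
  by (auto simp: inj_image_mem_iff)

lemma removable_nodes_swap:
  assumes "i < m"
  shows "removable_nodes m i (prod.swap ` c) = prod.swap ` removable_nodes m ((m - i) mod m) c"
proof -
  have "prod.swap b \<in> removable_nodes m i (prod.swap ` c) \<longleftrightarrow> b \<in> removable_nodes m ((m - i) mod m) c" for b
  proof -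
    have "prod.swap ` c - {prod.swap b} = prod.swap ` (c - {b})"
      by (simp add: image_set_diff)
    then show ?thesis
      by (simp add: removable_nodes_def residue_swap[OF assms])
  qed
  then show ?thesis
    by (metis (no_types, lifting) swap_image_mem swap_swap subsetI subset_antisym)
qed

lemma addable_nodes_swap:
  assumes "i < m"
  shows "addable_nodes m i (prod.swap ` c) = prod.swap ` addable_nodes m ((m - i) mod m) c"
proof -
  have "prod.swap b \<in> addable_nodes m i (prod.swap ` c) \<longleftrightarrow> b \<in> addable_nodes m ((m - i) mod m) c" for b
  proof -
    have "insert (prod.swap b) (prod.swap ` c) = prod.swap ` (insert b c)"
      by simp
    then show ?thesis
      by (simp only: addable_nodes_def mem_Collect_eq residue_swap[OF assms] is_partition_swap swap_image_mem)
  qed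
  then show ?thesis
    by (metis (no_types, lifting) swap_image_mem swap_swap subsetI subset_antisym)
qed

text \<open>
  Conjugation negates residues, so it exchanges \<open>s\<^sub>i\<close> with \<open>s\<^bsub>m-i\<^esub>\<close>; the outer \<open>mod\<close> is for
  \<open>i = 0\<close>.
\<close>

lemma core_reflection_swap:
  assumes "i < m"
  shows "core_reflection m i (prod.swap ` c) = prod.swap ` core_reflection m ((m - i) mod m) c"
  by (simp add: core_reflection_def removable_nodes_swap[OF assms] addable_nodes_swap[OF assms]
      image_set_diff image_Un)

lemma num_nodes_swap:
  assumes "i < m" "prod.swap ` c = c"
  shows "num_nodes m ((m - i) mod m) c = num_nodes m i c"
proof -
  have "{b \<in> c. residue m b = i} = prod.swap ` {b \<in> c. residue m b = (m - i) mod m}"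
  proof -
    have "b \<in> {b \<in> c. residue m b = i} \<longleftrightarrow> prod.swap b \<in> {b \<in> c. residue m b = (m - i) mod m}" for b
      using residue_swap[OF assms(1), of "prod.swap b"] swap_image_mem[of b c] by (simp add: assms(2))
    then show ?thesis
      by (metis (no_types, lifting) swap_image_mem swap_swap subsetI subset_antisym)
  qed
  then show ?thesis
    by (simp add: num_nodes_def card_image)
qed

section \<open>The Weyl group of type D\<close>

lemma cartan_opposite:
  assumes "0 < i" "i < n"
  shows "cartan (2*n) i (2*n - i) = 0" "cartan (2*n) (2*n - i) i = 0"
  using assms by (auto simp: cartan_def mod_Suc)

lemma D_generator_involution:
  assumes "2 \<le> n" "i \<le> n"
  shows "D_generator n i (D_generator n i x) = x"
proof (cases "i = 0 \<or> i = n")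
  case True
  then show ?thesis
    using assms by (auto simp: D_generator_def reflection_reflection)
next
  case False
  let ?s = "reflection (2*n) i" and ?t = "reflection (2*n) (2*n - i)"
  have "?s (?t (?s (?t x))) = ?s (?s (?t (?t x)))"
    using False assms by (subst (2) reflection_commute) (auto simp: cartan_opposite)
  also have "\<dots> = x"
    using False assms by (simp add: reflection_reflection)
  finally show ?thesis
    using False by (simp add: D_generator_def)
qed

lemma carrier_BijGroup_UNIV: "f \<in> carrier (BijGroup UNIV) \<longleftrightarrow> bij f"
  by (simp add: BijGroup_def Bij_def)

lemma mult_BijGroup_UNIV: "bij f \<Longrightarrow> bij g \<Longrightarrow> f \<otimes>\<^bsub>BijGroup UNIV\<^esub> g = f \<circ> g"
  by (simp add: BijGroup_def Bij_def compose_def fun_eq_iff)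

lemma one_BijGroup_UNIV: "\<one>\<^bsub>BijGroup UNIV\<^esub> = id"
  by (simp add: BijGroup_def fun_eq_iff)

text \<open>
  For a group generated by involutions, the case of inverses of generators in the induction rule
  \<open>generate.induct\<close> coincides with that of the generators themselves.
\<close>

lemma generate_involutions_induct [consumes 1, case_names involution id step comp]:
  assumes w: "w \<in> generate (BijGroup UNIV) S"
    and inv: "\<And>s x. s \<in> S \<Longrightarrow> s (s x) = x"
    and id: "P id"
    and step: "\<And>s. s \<in> S \<Longrightarrow> P s"
    and comp: "\<And>v w. P v \<Longrightarrow> P w \<Longrightarrow> P (v \<circ> w)"
  shows "P w"
proof -
  interpret G: group "BijGroup UNIV"
    by (rule group_BijGroup)
  have bij: "bij s" if "s \<in> S" for s
    using inv[OF that] by (intro o_bij[of s s]) (simp_all add: fun_eq_iff)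
  have sub: "S \<subseteq> carrier (BijGroup UNIV)"
    using bij by (auto simp: carrier_BijGroup_UNIV)
  show ?thesis
    using w
  proof induction
    case one
    show ?case unfolding one_BijGroup_UNIV by (rule id)
  next
    case (incl h)
    then show ?case by (rule step)
  next
    case (inv h)
    have "h \<otimes>\<^bsub>BijGroup UNIV\<^esub> h = \<one>\<^bsub>BijGroup UNIV\<^esub>"
      using inv bij assms(2) by (simp add: mult_BijGroup_UNIV one_BijGroup_UNIV fun_eq_iff)
    then have "inv\<^bsub>BijGroup UNIV\<^esub> h = h"
      using inv sub by (intro G.inv_equality) auto
    then show ?case
      using inv step by simp
  next
    case (eng v w)
    then have "bij v" "bij w"
      using G.generate_in_carrier[OF sub] by (simp_all add: carrier_BijGroup_UNIV)
    then show ?case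
      using eng comp by (metis mult_BijGroup_UNIV)
  qed
qed

lemma D_generators_subset_carrier:
  assumes "2 \<le> n"
  shows "D_generator n ` {0..n} \<subseteq> carrier (BijGroup UNIV)"
proof -
  have "bij (D_generator n i)" if "i \<le> n" for i
    using D_generator_involution[OF assms that] by (intro o_bij[of "D_generator n i" "D_generator n i"]) (simp_all add: fun_eq_iff)
  then show ?thesis
    by (auto simp: carrier_BijGroup_UNIV)
qed

lemma D_generator_foldr:
  assumes "2 \<le> n" "i \<le> n"
  shows "\<exists>is\<in>lists {..<2*n}. D_generator n i = foldr (reflection (2*n)) is"
proof (cases "i = 0 \<or> i = n")
  case True
  then show ?thesis
    using assms by (intro bexI[of _ "[i]"]) (auto simp: D_generator_def)
next
  case False
  then show ?thesis
    using assms by (intro bexI[of _ "[i, 2*n - i]"]) (auto simp: D_generator_def)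
qed

lemma D_weyl_foldr:
  assumes "2 \<le> n" "w \<in> D_weyl n"
  shows "\<exists>is\<in>lists {..<2*n}. w = foldr (reflection (2*n)) is"
  using assms(2)[unfolded D_weyl_def]
proof (induction rule: generate_involutions_induct)
  case (involution s x)
  then show ?case using D_generator_involution[OF assms(1)] by auto
next
  case id
  show ?case by (rule bexI[of _ "[]"]) (auto simp: fun_eq_iff)
next
  case (step s)
  then show ?case using D_generator_foldr[OF assms(1)] by auto
next
  case (comp v w)
  then obtain "is" js where "is \<in> lists {..<2*n}" "js \<in> lists {..<2*n}"
    "v = foldr (reflection (2*n)) is" "w = foldr (reflection (2*n)) js" by blast
  then show ?case
    by (intro bexI[of _ "is @ js"]) (auto simp: fun_eq_iff)
qed

lemma D_finite_weyl_fixes_fund_weight: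
  assumes "2 \<le> n" "u \<in> D_finite_weyl n"
  shows "u (fund_weight 0) = fund_weight 0"
  using assms(2)[unfolded D_finite_weyl_def]
proof (induction rule: generate_involutions_induct)
  case (involution s x)
  then show ?case using D_generator_involution[OF assms(1)] by auto
next
  case (step s)
  then show ?case by (auto simp: D_generator_def reflection_def)
qed simp_all

lemma core_action_D_weyl_eq_iff:
  assumes "2 \<le> n" "w \<in> D_weyl n" "c \<in> cores (2*n)"
  shows "core_action (2*n) w {} = c \<longleftrightarrow> w (fund_weight 0) = partition_weight (2*n) c"
proof -
  obtain "is" where "is \<in> lists {..<2*n}" "w = foldr (reflection (2*n)) is"
    using D_weyl_foldr[OF assms(1,2)] by blast
  then show ?thesis
    using core_action_empty_eq_iff[OF _ _ assms(3)] assms(1) by simp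
qed

text \<open>
  Induction on the number of boxes. A removable box and its transpose have opposite residues, so the
  generator \<open>s\<^sub>i s\<^bsub>2n-i\<^esub>\<close> (or \<open>s\<^sub>0\<close>, \<open>s\<^sub>n\<close>) removes boxes, and its result is again self-conjugate.
\<close>

lemma self_conjugate_core_weight_in_D_weyl_orbit:
  assumes "2 \<le> n" "c \<in> self_conjugate_cores (2*n)"
  shows "\<exists>w \<in> D_weyl n. w (fund_weight 0) = partition_weight (2*n) c"
  using assms(2)
proof (induction "card c" arbitrary: c rule: less_induct)
  case less
  interpret G: group "BijGroup UNIV"
    by (rule group_BijGroup)
  define m where "m = 2*n"
  have m: "3 \<le> m" "2 \<le> m"
    using assms(1) by (simp_all add: m_def)
  have c: "c \<in> cores m" "prod.swap ` c = c"
    using less.prems by (simp_all add: self_conjugate_cores_def m_def)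
  then have part: "is_partition c"
    by (simp add: cores_def)
  show ?case
  proof (cases "c = {}")
    case True
    have "id \<in> D_weyl n"
      unfolding D_weyl_def one_BijGroup_UNIV[symmetric] by (rule generate.one)
    then show ?thesis
      using True by (intro bexI[of _ id]) auto
  next
    case False
    then obtain b where b: "b \<in> removable_nodes m (residue m b) c"
      using nonempty_partition_has_removable[OF part] by blast
    have opposite: "removable_nodes m ((m - k) mod m) c \<noteq> {}"
      if "removable_nodes m k c \<noteq> {}" "k < m" for k
      using removable_nodes_swap[OF that(2), of c] that(1) by (auto simp: c(2))
    \<comment> \<open>of the two opposite residues, the one that indexes a generator\<close>
    define i where "i = (if residue m b \<le> n then residue m b else m - residue m b)"
    have res: "residue m b < m" "removable_nodes m (residue m b) c \<noteq> {}"
      using m residue_less[of m b] b by auto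
    then have "removable_nodes m ((m - residue m b) mod m) c \<noteq> {}"
      using opposite by blast
    then have i: "i \<le> n" "i < m" "removable_nodes m i c \<noteq> {}"
      using res assms(1) by (auto simp: i_def m_def)
    have "\<exists>d. d \<in> cores m \<and> prod.swap ` d = d \<and> card d < card c \<and>
      partition_weight m d = D_generator n i (partition_weight m c)"
    proof (cases "i = 0 \<or> i = n")
      case True
      then have "(m - i) mod m = i"
        using assms(1) by (auto simp: m_def)
      then have "prod.swap ` core_reflection m i c = core_reflection m i c"
        using core_reflection_swap[OF i(2), of c] c(2) by simp
      then show ?thesis
        using True core_reflection_in_cores[OF c(1) i(2) m(2)] card_core_reflection_less[OF part i(3)]
          partition_weight_core_reflection[OF c(1) m(1) i(2)]
        by (intro exI[of _ "core_reflection m i c"]) (auto simp: D_generator_def m_def)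
    next
      case False
      define j where "j = m - i"
      have ij: "j < m" "(m - i) mod m = j" "(m - j) mod m = i"
        using False i by (auto simp: j_def)
      have cartan: "cartan m i j = 0" "cartan m j i = 0"
        using False i(1) cartan_opposite[of i n] by (simp_all add: m_def j_def)
      let ?s = "core_reflection m i" and ?t = "core_reflection m j"
      note mem = core_reflection_in_cores[OF _ i(2) m(2)] core_reflection_in_cores[OF _ ij(1) m(2)]
      note wt = partition_weight_core_reflection[OF _ m(1) i(2)] partition_weight_core_reflection[OF _ m(1) ij(1)]
      \<comment> \<open>the commutation of core reflections is inherited from the weights\<close>
      have "?s (?t c) = ?t (?s c)"
        using c(1) by (intro partition_weight_inj_on_cores[OF m(1)])
          (simp_all add: mem wt reflection_commute[OF i(2) ij(1) cartan])
      moreover have "prod.swap ` ?s (?t c) = ?t (?s c)"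
        using core_reflection_swap[OF ij(1), of "?t c"] core_reflection_swap[OF i(2), of c] c(2) ij by simp
      ultimately have swap: "prod.swap ` ?s (?t c) = ?s (?t c)"
        by simp
      have "removable_nodes m j c \<noteq> {}"
        using opposite[OF i(3,2)] ij by simp
      then have t: "card (?t c) < card c"
        by (rule card_core_reflection_less[OF part])
      \<comment> \<open>the opposite simple roots are orthogonal, so the first reflection leaves the other pairing negative\<close>
      have "pairing (partition_weight m (?t c)) i = pairing (partition_weight m c) i"
        using c(1) i(2) cartan by (simp add: wt reflection_def pairing_simple_root)
      then have "removable_nodes m i (?t c) \<noteq> {}"
        using i(3) pairing_neg_iff_removable[OF _ m(1) i(2)] c(1) mem(2) by metis
      then have "card (?s (?t c)) < card (?t c)"
        using mem(2)[OF c(1)] by (intro card_core_reflection_less) (simp_all add: cores_def)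
      moreover have "partition_weight m (?s (?t c)) = D_generator n i (partition_weight m c)"
        using False c(1) by (simp add: mem wt) (simp add: D_generator_def m_def j_def)
      moreover have "?s (?t c) \<in> cores m"
        using c(1) by (simp add: mem)
      ultimately show ?thesis
        using swap t by (meson less_trans)
    qed
    then obtain d where d: "d \<in> self_conjugate_cores (2*n)" "card d < card c"
      "partition_weight (2*n) d = D_generator n i (partition_weight (2*n) c)"
      by (auto simp: self_conjugate_cores_def m_def)
    then obtain w where w: "w \<in> D_weyl n" "w (fund_weight 0) = partition_weight (2*n) d"
      using less.hyps by blast
    have g: "D_generator n i \<in> D_weyl n"
      unfolding D_weyl_def using i(1) by (intro generate.incl) auto
    then have "bij (D_generator n i)" "bij w"
      using w(1) G.generate_in_carrier[OF D_generators_subset_carrier[OF assms(1)]]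
      unfolding D_weyl_def carrier_BijGroup_UNIV[symmetric] by blast+
    then have "D_generator n i \<circ> w \<in> D_weyl n"
      using generate.eng[OF g[unfolded D_weyl_def] w(1)[unfolded D_weyl_def]]
      by (simp add: D_weyl_def mult_BijGroup_UNIV)
    moreover have "(D_generator n i \<circ> w) (fund_weight 0) = partition_weight (2*n) c"
      using w(2) d(3) D_generator_involution[OF assms(1) i(1)] by simp
    ultimately show ?thesis by blast
  qed
qed

text \<open>
  A shortest element of the coset differs from \<open>w\<close> by an element of the finite Weyl group on the right,
  and this fixes \<open>\<Lambda>\<^sub>0\<close>.
\<close>

lemma D_grassmannian_representative:
  assumes "2 \<le> n" "w \<in> D_weyl n"
  shows "\<exists>v \<in> D_grassmannian n. v (fund_weight 0) = w (fund_weight 0)"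
proof -
  interpret G: group "BijGroup UNIV"
    by (rule group_BijGroup)
  let ?G = "BijGroup UNIV" and ?H = "D_finite_weyl n"
  have gens: "D_generator n ` {1..n} \<subseteq> D_generator n ` {0..n}"
    by auto
  then have "?H \<subseteq> D_weyl n"
    unfolding D_weyl_def D_finite_weyl_def by (rule G.mono_generate)
  have sub: "subgroup (D_weyl n) ?G" "subgroup ?H ?G"
    unfolding D_weyl_def D_finite_weyl_def
    using D_generators_subset_carrier[OF assms(1)] gens
    by (meson G.generate_is_subgroup order_trans)+
  have w: "w \<in> carrier ?G"
    using subgroup.mem_carrier[OF sub(1) assms(2)] .
  have "w \<in> w <#\<^bsub>?G\<^esub> ?H"
    using w subgroup.one_closed[OF sub(2)] by (force simp: l_coset_def)
  then obtain v where v: "v \<in> w <#\<^bsub>?G\<^esub> ?H"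
    and least: "\<And>v'. v' \<in> w <#\<^bsub>?G\<^esub> ?H \<Longrightarrow> D_length n v \<le> D_length n v'"
    using ex_has_least_nat[of "\<lambda>v. v \<in> w <#\<^bsub>?G\<^esub> ?H" w "D_length n"] by blast
  then obtain u where u: "u \<in> ?H" "v = w \<otimes>\<^bsub>?G\<^esub> u"
    by (auto simp: l_coset_def)
  have "v \<in> D_weyl n"
    using u \<open>?H \<subseteq> D_weyl n\<close> subgroup.m_closed[OF sub(1) assms(2)] by auto
  moreover have "v <#\<^bsub>?G\<^esub> ?H = w <#\<^bsub>?G\<^esub> ?H"
    using G.l_repr_independence[OF v w sub(2)] by simp
  ultimately have "v \<in> D_grassmannian n"
    using least by (simp add: D_grassmannian_def)
  moreover have "v (fund_weight 0) = w (fund_weight 0)"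
  proof -
    have "bij u" "bij w"
      using subgroup.mem_carrier[OF sub(2) u(1)] w by (simp_all add: carrier_BijGroup_UNIV)
    then show ?thesis
      using u D_finite_weyl_fixes_fund_weight[OF assms(1) u(1)] by (simp add: mult_BijGroup_UNIV)
  qed
  ultimately show ?thesis by blast
qed

section \<open>The atomic length\<close>

text \<open>
  Grouping the residues modulo \<open>2n\<close> into the pairs of opposite ones. It is used both for the simple
  roots and for the numbers of boxes.
\<close>

lemma sum_fold_opposite:
  fixes h :: "nat \<Rightarrow> 'a :: comm_monoid_add"
  assumes "0 < n"
  shows "(\<Sum>j<2*n. h j) = (\<Sum>i=0..n. h i + (if i = 0 \<or> i = n then 0 else h (2*n - i)))"
proof -
  have "{..<2*n} = {0..n} \<union> {n<..<2*n}" "{0..n} \<inter> {n<..<2*n} = {}"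
    using assms by auto
  then have "(\<Sum>j<2*n. h j) = (\<Sum>i=0..n. h i) + (\<Sum>j\<in>{n<..<2*n}. h j)"
    by (simp add: sum.union_disjoint)
  also have "(\<Sum>j\<in>{n<..<2*n}. h j) = (\<Sum>i\<in>{0<..<n}. h (2*n - i))"
    by (rule sum.reindex_bij_witness[of _ "\<lambda>i. 2*n - i" "\<lambda>j. 2*n - j"]) auto
  also have "\<dots> = (\<Sum>i=0..n. if i = 0 \<or> i = n then 0 else h (2*n - i))"
    by (rule sum.mono_neutral_cong_left) auto
  finally show ?thesis
    by (simp add: sum.distrib)
qed

lemma sum_D_simple_root:
  assumes "0 < n"
  shows "(\<Sum>i=0..n. a i *\<^sub>R D_simple_root n i) =
    (\<Sum>j<2*n. a (if j \<le> n then j else 2*n - j) *\<^sub>R simple_root (2*n) j)"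
  unfolding sum_fold_opposite[OF assms]
  by (rule sum.cong) (auto simp: D_simple_root_def scaleR_add_right)

text \<open>
  By conjugation symmetry the type D combination with coefficients \<open>a\<^sub>i(c)\<close> expands to
  \<open>\<Lambda>\<^sub>0 - wt c\<close>. A Grassmannian element that maps \<open>\<Lambda>\<^sub>0\<close> to \<open>wt c\<close> exists, and every
  Grassmannian element acting as required has this effect on \<open>\<Lambda>\<^sub>0\<close>, so the definite description
  picks these coefficients.
\<close>

lemma D_coeff_eq_num_nodes:
  assumes "2 \<le> n" and c: "c \<in> self_conjugate_cores (2*n)"
  shows "D_coeff n c = (\<lambda>i. if i \<le> n then real (num_nodes (2*n) i c) else 0)"
proof -
  define A where "A = (\<lambda>i. if i \<le> n then real (num_nodes (2*n) i c) else 0)"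
  have core: "c \<in> cores (2*n)" and swap: "prod.swap ` c = c"
    using c by (simp_all add: self_conjugate_cores_def)
  have "finite c"
    using core is_partition_finite by (simp add: cores_def)
  have "num_nodes (2*n) (2*n - j) c = num_nodes (2*n) j c" if "n < j" "j < 2*n" for j
    using num_nodes_swap[OF that(2) swap] that by simp
  then have "(\<Sum>i=0..n. A i *\<^sub>R D_simple_root n i) =
    (\<Sum>j<2*n. real (num_nodes (2*n) j c) *\<^sub>R simple_root (2*n) j)"
    using assms(1) by (subst sum_D_simple_root) (auto simp: A_def intro!: sum.cong)
  then have A: "(\<Sum>i=0..n. A i *\<^sub>R D_simple_root n i) = fund_weight 0 - partition_weight (2*n) c"
    using sum_simple_root_residue[OF \<open>finite c\<close>, of "2*n"] assms(1) by (simp add: partition_weight_def)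
  have action: "core_action (2*n) w {} = c \<longleftrightarrow> w (fund_weight 0) = partition_weight (2*n) c"
    if "w \<in> D_grassmannian n" for w
    using core_action_D_weyl_eq_iff[OF assms(1) _ core] that by (simp add: D_grassmannian_def)
  show ?thesis
    unfolding D_coeff_def A_def[symmetric]
  proof (rule the_equality)
    obtain w where "w \<in> D_grassmannian n" "w (fund_weight 0) = partition_weight (2*n) c"
      using self_conjugate_core_weight_in_D_weyl_orbit[OF assms] D_grassmannian_representative[OF assms(1)]
      by metis
    then show "(\<forall>i>n. A i = 0) \<and> (\<exists>w\<in>D_grassmannian n. core_action (2*n) w {} = c \<and>
        D_fund_weight0 - w D_fund_weight0 = (\<Sum>i=0..n. A i *\<^sub>R D_simple_root n i))"
      using action by (auto simp: A_def[symmetric] A D_fund_weight0_def) (simp add: A_def)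
  next
    fix a assume a: "(\<forall>i>n. a i = 0) \<and> (\<exists>w\<in>D_grassmannian n. core_action (2*n) w {} = c \<and>
        D_fund_weight0 - w D_fund_weight0 = (\<Sum>i=0..n. a i *\<^sub>R D_simple_root n i))"
    then have "(\<Sum>i=0..n. a i *\<^sub>R D_simple_root n i) = (\<Sum>i=0..n. A i *\<^sub>R D_simple_root n i)"
      unfolding A using action by (auto simp: D_fund_weight0_def)
    then have eq: "a (if j \<le> n then j else 2*n - j) = A (if j \<le> n then j else 2*n - j)" if "j < 2*n" for j
      using that assms(1) simple_roots_independent[of "2*n" "\<lambda>j. a (if j \<le> n then j else 2*n - j)"
          "\<lambda>j. A (if j \<le> n then j else 2*n - j)" j]
      by (simp add: sum_D_simple_root)
    have "a i = A i" if "i \<le> n" for i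
      using eq[of i] that assms(1) by simp
    then show "a = A"
      using a by (auto simp: fun_eq_iff A_def not_le)
  qed
qed

theorem proposition5p5:
  fixes n :: nat and c :: "(nat \<times> nat) set"
  assumes "n \<ge> 2" and "c \<in> self_conjugate_cores (2*n)"
  shows "D_atomic_length n c =
           1/2 * (real (card c) + real (num_nodes (2*n) 0 c) + real (num_nodes (2*n) n c))"
proof -
  let ?a = "\<lambda>i. real (num_nodes (2*n) i c)"
  have swap: "prod.swap ` c = c" and "finite c"
    using assms(2) is_partition_finite by (simp_all add: self_conjugate_cores_def cores_def)
  have opposite: "num_nodes (2*n) (2*n - i) c = num_nodes (2*n) i c" if "0 < i" "i < n" for i
    using num_nodes_swap[OF _ swap, of i "2*n"] that by simp
  have "real (card c) = (\<Sum>j<2*n. ?a j)"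
    using card_eq_sum_num_nodes[OF \<open>finite c\<close>, of "2*n"] assms(1) by simp
  also have "\<dots> = (\<Sum>i=0..n. 2 * ?a i - (if i = 0 then ?a i else 0) - (if i = n then ?a i else 0))"
    unfolding sum_fold_opposite[OF less_le_trans[OF zero_less_numeral assms(1)]]
    using assms(1) by (intro sum.cong) (auto simp: opposite)
  also have "\<dots> = 2 * (\<Sum>i=0..n. ?a i) - ?a 0 - ?a n"
    by (simp add: sum_subtractf sum_distrib_left[symmetric])
  finally show ?thesis
    by (simp add: D_atomic_length_def D_coeff_eq_num_nodes[OF assms])
qed

end
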